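(* Let $(L,[p])$ be a nilpotent restricted Lie algebra of finite dimension $>1$ over a field $\mathbb{F}$ of characteristic $p>0$. Then $L$ has an outer restricted derivation $D$ with $D^2=0$ unless $L$ is a torus or $p=2$ and $L\cong\mathfrak{h}_1(\mathbb{F})$ as ordinary Lie algebras. (That is, if $L$ is not a torus and it is not the case that both $p=2$ and $L\cong\mathfrak{h}_1(\mathbb{F})$ as ordinary Lie algebras, then such a $D$ exists.)
   Context: A restricted Lie algebra $(L,[p])$ over a field of characteristic $p>0$ is a Lie algebra with a $p$-mapping $x\mapsto x^{[p]}$. A derivation $D$ of $L$ is called restricted if $D(x^{[p]})=(\mathrm{ad}_L x)^{p-1}(D(x))$ for every $x\in L$. A derivation is inner if it equals $\mathrm{ad}_L a$ for some $a\in L$ (every inner derivation is restricted); an outer restricted derivation is a restricted derivation that is not inner. $D^2=D\circ D$ is the composition as a linear map. An element $x\in L$ is semisimple if $x\in\langle x^{[p]}\rangle_p$, where $\langle S\rangle_p$ denotes the $p$-subalgebra (subalgebra closed under the $p$-mapping) generated by $S$; a torus is an abelian restricted Lie algebra all of whose elements are semisimple. $\mathfrak{h}_1(\mathbb{F})=\mathbb{F}x+\mathbb{F}y+\mathbb{F}z$ is the three-dimensional Heisenberg algebra, with $[x,y]=z$ and $z$ central. "Isomorphic as ordinary Lie algebras" means isomorphic as Lie algebras, disregarding the $p$-mappings. *)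

theory Defs
  imports
    "HOL-Analysis.Cartesian_Space"
    "HOL-Computational_Algebra.Polynomial"
begin

section \<open>Lie algebras\<close>

locale lie_algebra = vector_space scale
  for scale :: "'f::field \<Rightarrow> 'v::ab_group_add \<Rightarrow> 'v" (infixr \<open>\<cdot>\<close> 75) +
  fixes bracket :: "'v \<Rightarrow> 'v \<Rightarrow> 'v"
  assumes bracket_add_left: "bracket (x + y) z = bracket x z + bracket y z"
    and bracket_add_right: "bracket x (y + z) = bracket x y + bracket x z"
    and bracket_scale_left: "bracket (a \<cdot> x) y = a \<cdot> bracket x y"
    and bracket_scale_right: "bracket x (a \<cdot> y) = a \<cdot> bracket x y"
    and bracket_self: "bracket x x = 0"
    and jacobi: "bracket x (bracket y z) + bracket y (bracket z x) + bracket z (bracket x y) = 0"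
begin

abbreviation ad :: "'v \<Rightarrow> 'v \<Rightarrow> 'v"
  where "ad x \<equiv> bracket x"

primrec lower_central :: "nat \<Rightarrow> 'v set"
  where
    "lower_central 0 = UNIV"
  | "lower_central (Suc n) = span {bracket x y | x y. y \<in> lower_central n}"

definition nilpotent :: bool
  where "nilpotent \<longleftrightarrow> (\<exists>n. lower_central n = {0})"

definition abelian :: bool
  where "abelian \<longleftrightarrow> (\<forall>x y. bracket x y = 0)"

definition derivation :: "('v \<Rightarrow> 'v) \<Rightarrow> bool"
  where "derivation D \<longleftrightarrow>
    Vector_Spaces.linear scale scale D \<and>
    (\<forall>x y. D (bracket x y) = bracket (D x) y + bracket x (D y))"

definition inner_derivation :: "('v \<Rightarrow> 'v) \<Rightarrow> bool"
  where "inner_derivation D \<longleftrightarrow> (\<exists>a. D = ad a)"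

end

definition lie_isomorphic ::
    "('f::field \<Rightarrow> 'v::ab_group_add \<Rightarrow> 'v) \<Rightarrow> ('v \<Rightarrow> 'v \<Rightarrow> 'v) \<Rightarrow>
     ('f \<Rightarrow> 'w::ab_group_add \<Rightarrow> 'w) \<Rightarrow> ('w \<Rightarrow> 'w \<Rightarrow> 'w) \<Rightarrow> bool"
  where "lie_isomorphic scale1 bracket1 scale2 bracket2 \<longleftrightarrow>
    (\<exists>f. Vector_Spaces.linear scale1 scale2 f \<and> bij f \<and>
         (\<forall>x y. f (bracket1 x y) = bracket2 (f x) (f y)))"


section \<open>Restricted Lie algebras\<close>

text \<open>
  Elements of the Lie algebra \<open>L \<otimes> F[X]\<close> are polynomials with coefficients in \<open>L\<close>;
  the following is the map \<open>ad (x \<otimes> X + y \<otimes> 1)\<close> on them.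
\<close>

definition (in lie_algebra) ad_poly :: "'v \<Rightarrow> 'v \<Rightarrow> 'v poly \<Rightarrow> 'v poly"
  where "ad_poly x y q = pCons 0 (map_poly (ad x) q) + map_poly (ad y) q"

lemma (in lie_algebra) coeff_ad_poly:
  "coeff (ad_poly x y q) n =
    (case n of 0 \<Rightarrow> 0 | Suc m \<Rightarrow> bracket x (coeff q m)) + bracket y (coeff q n)"
proof -
  have "bracket u 0 = 0" for u
    using bracket_add_right[of u 0 0] by simp
  then show ?thesis
    by (simp add: ad_poly_def coeff_pCons coeff_map_poly split: nat.split)
qed

text \<open>
  Jacobson's \<open>s\<^sub>i(x, y)\<close>, for \<open>1 \<le> i \<le> p - 1\<close>, is determined by
  \<open>(ad (x \<otimes> X + y \<otimes> 1))\<^sup>p\<^sup>-\<^sup>1 (x \<otimes> 1) = (\<Sum>i = 1..p-1. i s\<^sub>i(x, y) \<otimes> X\<^sup>i\<^sup>-\<^sup>1)\<close>.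
\<close>

definition (in lie_algebra) jacobson_s :: "nat \<Rightarrow> nat \<Rightarrow> 'v \<Rightarrow> 'v \<Rightarrow> 'v"
  where "jacobson_s p i x y =
    inverse (of_nat i) \<cdot> coeff ((ad_poly x y ^^ (p - 1)) [:x:]) (i - 1)"

locale restricted_lie_algebra = lie_algebra scale bracket
  for scale :: "'f::field \<Rightarrow> 'v::ab_group_add \<Rightarrow> 'v" (infixr \<open>\<cdot>\<close> 75)
    and bracket :: "'v \<Rightarrow> 'v \<Rightarrow> 'v" +
  fixes p :: nat
    and pmap :: "'v \<Rightarrow> 'v"
  assumes char_eq: "CHAR('f) = p"
    and char_pos: "p > 0"
    and ad_pmap: "ad (pmap x) = ad x ^^ p"
    and pmap_scale: "pmap (a \<cdot> x) = a ^ p \<cdot> pmap x"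
    and pmap_add: "pmap (x + y) = pmap x + pmap y + (\<Sum>i = 1..p - 1. jacobson_s p i x y)"
begin

definition p_subalgebra :: "'v set \<Rightarrow> bool"
  where "p_subalgebra H \<longleftrightarrow>
    subspace H \<and> (\<forall>x\<in>H. \<forall>y\<in>H. bracket x y \<in> H) \<and> (\<forall>x\<in>H. pmap x \<in> H)"

definition semisimple :: "'v \<Rightarrow> bool"
  where "semisimple x \<longleftrightarrow> x \<in> p_subalgebra hull {pmap x}"

definition torus :: bool
  where "torus \<longleftrightarrow> abelian \<and> (\<forall>x. semisimple x)"

definition restricted_derivation :: "('v \<Rightarrow> 'v) \<Rightarrow> bool"
  where "restricted_derivation D \<longleftrightarrow>
    derivation D \<and> (\<forall>x. D (pmap x) = (ad x ^^ (p - 1)) (D x))"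

definition outer_restricted_derivation :: "('v \<Rightarrow> 'v) \<Rightarrow> bool"
  where "outer_restricted_derivation D \<longleftrightarrow>
    restricted_derivation D \<and> \<not> inner_derivation D"

end


section \<open>The three-dimensional Heisenberg algebra\<close>

text \<open>
  The basis \<open>x, y, z\<close> of the Heisenberg algebra is \<open>axis 1 1, axis 2 1, axis 3 1\<close>.
\<close>

definition heisenberg_bracket :: "'f::field ^ 3 \<Rightarrow> 'f ^ 3 \<Rightarrow> 'f ^ 3"
  where "heisenberg_bracket u v = axis 3 (u $ 1 * v $ 2 - u $ 2 * v $ 1)"

lemma heisenberg_bracket_basis:
  "heisenberg_bracket (axis 1 1) (axis 2 1) = (axis 3 1 :: 'f::field ^ 3)"
  "heisenberg_bracket (axis 3 1) v = (0 :: 'f ^ 3)"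
  by (simp_all add: heisenberg_bracket_def axis_def vec_eq_iff)

lemma lie_algebra_heisenberg: "lie_algebra (*s) (heisenberg_bracket :: 'f::field ^ 3 \<Rightarrow> _)"
  by unfold_locales
    (auto simp: heisenberg_bracket_def axis_def vec_eq_iff algebra_simps)

end

theory Submission
  imports Defs "HOL-Library.Function_Algebras" "HOL-Computational_Algebra.Primes"
begin

text \<open>
  Suppose that every restricted derivation of square zero is inner.  If \<open>L\<close> is abelian
  and not a torus, the \<open>p\<close>-th powers do not span \<open>L\<close>; a nonzero linear form that kills them, times
  a nonzero element of its kernel, contradicts the assumption (\<open>abelian_case\<close>).

  If \<open>L\<close> is not abelian, take an ideal \<open>A\<close> that is its own centralizer.  It is an abelian
  \<open>p\<close>-ideal and a restricted \<open>L/A\<close>-module.  A derivation with values in \<open>A\<close> that vanishes on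
  \<open>A\<close> has square zero, so the assumption says that the restricted cohomology \<open>H\<^sup>1(L/A, A)\<close> is
  zero.  Over the restricted enveloping algebra of a \<open>p\<close>-nilpotent Lie algebra a finite-dimensional
  module with vanishing \<open>H\<^sup>1\<close> is free, and \<open>H\<^sup>2\<close> vanishes too.  Both consequences are obtained here
  by climbing down and up a chain of \<open>p\<close>-ideals \<open>N\<close> between \<open>A\<close> and \<open>L\<close> whose successive
  quotients are central lines spanned by elements \<open>x\<close>: a derivation \<open>N \<rightarrow> A\<close> extends over \<open>x\<close> once
  its commutator with \<open>ad x\<close> is inner and the \<open>N\<close>-invariants of \<open>A\<close> are free over \<open>ad x\<close>
  (\<open>extend_derivation\<close>); the vanishing of \<open>H\<^sup>1\<close> for the larger ideal yields the freeness
  (\<open>free_if_inner_on\<close>) and then, by nilpotency, the vanishing for the smaller one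
  (\<open>inner_on_descend\<close>).

  Going up the chain, the identity of \<open>A\<close> extends to a derivation \<open>L \<rightarrow> A\<close> that is restricted up
  to central errors (\<open>exists_retraction_derivation\<close>), as though \<open>L\<close> were a split extension of
  \<open>A\<close>.  Such a derivation carries the span \<open>\<Phi>\<close> of the brackets and the \<open>p\<close>-th powers into
  \<open>[L, A]\<close>, which is smaller than \<open>A\<close>.  Hence \<open>A\<close> is not contained in \<open>\<Phi>\<close>
  (\<open>A_not_subset_Frattini\<close>), and there is a hyperplane \<open>I\<close> containing \<open>\<Phi>\<close> with a complement
  \<open>x\<close> in \<open>A\<close>.  As \<open>(ad x)\<^sup>2 = 0\<close>, the derivations that kill \<open>I\<close> and send \<open>x\<close> into the center of
  \<open>I\<close> include an outer one if \<open>p > 2\<close>.  For \<open>p = 2\<close> they produce an \<open>e\<close> that commutes with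
  \<open>I\<close> and for which \<open>z = [e, x]\<close> is central and nonzero; freeness of \<open>A\<close> over \<open>ad e\<close>, whose
  rank on \<open>A\<close> is one, leaves only \<open>L = \<langle>e, x, z\<rangle>\<close> (\<open>heisenberg_basis_exists\<close>).

  All of this rests on one identity in characteristic \<open>p\<close> (\<open>commutator_W_pow_interchange\<close>).
  Applied to polynomials over \<open>L\<close>, it shows that the failure of a derivation to be restricted is
  additive (\<open>defect_add\<close>), so that restrictedness can be checked on generators; applied to \<open>L\<close>,
  it shows that commutators of restricted derivations are restricted (\<open>defect_commutator\<close>).
\<close>

section \<open>Leibniz operators in characteristic p\<close>

lemma choose_pred_prime_mod:
  assumes "CHAR('f::field) = p" "p > 0" "k \<le> p - 1"
  shows "of_nat (p - 1 choose k) = ((-1) ^ k :: 'f)"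
  using assms(3)
proof (induction k)
  case (Suc k)
  have "prime p" using assms prime_CHAR_semidom[where 'a='f] by auto
  then have "p dvd (p choose Suc k)"
    using Suc.prems by (intro dvd_choose_prime) auto
  then have "of_nat (p choose Suc k) = (0::'f)"
    using assms(1) of_nat_eq_0_iff_char_dvd by blast
  moreover have "p choose Suc k = (p - 1 choose k) + (p - 1 choose Suc k)"
    using \<open>p > 0\<close> by (cases p) auto
  ultimately have "(of_nat (p - 1 choose k) + of_nat (p - 1 choose Suc k) :: 'f) = 0"
    by simp
  with Suc show ?case by (simp add: add_eq_0_iff)
qed simp

text \<open>
  The abstract setting covers two cases: a Lie algebra with \<open>W = ad y\<close>, and the polynomials over
  a Lie algebra with \<open>W = ad (x X + y)\<close>.
\<close>

locale leibniz_bracket = vector_space scale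
  for scale :: "'f::field \<Rightarrow> 'g::ab_group_add \<Rightarrow> 'g" (infixr \<open>\<star>\<close> 75) +
  fixes B :: "'g \<Rightarrow> 'g \<Rightarrow> 'g" and W :: "'g \<Rightarrow> 'g"
  assumes B_add_left: "B (u + u') v = B u v + B u' v"
    and B_add_right: "B u (v + v') = B u v + B u v'"
    and B_swap: "B u v = - B v u"
    and W_add: "W (u + v) = W u + W v"
    and W_scale: "W (a \<star> u) = a \<star> W u"
    and W_B: "W (B u v) = B (W u) v + B u (W v)"
begin

lemma W_zero: "W 0 = 0"
  using W_add[of 0 0] by simp

lemma W_sum: "W (\<Sum>i\<in>I. f i) = (\<Sum>i\<in>I. W (f i))"
  by (induction I rule: infinite_finite_induct) (auto simp: W_zero W_add)

text \<open>
  The Leibniz expansions of the summands add up to binomial coefficients by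
  \<open>\<Sum>j<k. binom j i = binom k (i + 1)\<close>.
\<close>

lemma W_pow_B_sum:
  "(\<Sum>j<k. (W ^^ j) (B m ((W ^^ (k - 1 - j)) q))) =
   (\<Sum>i<k. of_nat (k choose Suc i) \<star> B ((W ^^ i) m) ((W ^^ (k - 1 - i)) q))"
proof (induction k)
  case (Suc k)
  define b where "b i = B ((W ^^ i) m) ((W ^^ (k - i)) q)" for i
  have "(\<Sum>j<Suc k. (W ^^ j) (B m ((W ^^ (Suc k - 1 - j)) q)))
      = B m ((W ^^ k) q) + (\<Sum>j<k. W ((W ^^ j) (B m ((W ^^ (k - 1 - j)) q))))"
    by (subst sum.lessThan_Suc_shift) simp
  also have "(\<Sum>j<k. W ((W ^^ j) (B m ((W ^^ (k - 1 - j)) q))))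
      = W (\<Sum>i<k. of_nat (k choose Suc i) \<star> B ((W ^^ i) m) ((W ^^ (k - 1 - i)) q))"
    by (simp only: W_sum[symmetric] Suc.IH)
  also have "\<dots> = (\<Sum>i<k. of_nat (k choose Suc i) \<star> (b (Suc i) + b i))"
  proof -
    have "W (B ((W ^^ i) m) ((W ^^ (k - 1 - i)) q)) = b (Suc i) + b i" if "i < k" for i
    proof -
      have e: "k - i = Suc (k - 1 - i)" "k - Suc i = k - 1 - i" using that by auto
      show ?thesis unfolding b_def e by (simp add: W_B)
    qed
    then show ?thesis by (simp add: W_sum W_scale)
  qed
  also have "\<dots> = (\<Sum>i<k. of_nat (k choose Suc i) \<star> b (Suc i))
      + (\<Sum>i<k. of_nat (k choose Suc i) \<star> b i)"
    by (simp add: scale_right_distrib sum.distrib)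
  also have "B m ((W ^^ k) q) + ((\<Sum>i<k. of_nat (k choose Suc i) \<star> b (Suc i))
      + (\<Sum>i<k. of_nat (k choose Suc i) \<star> b i))
      = (\<Sum>i<Suc k. of_nat (k choose i) \<star> b i) + (\<Sum>i<Suc k. of_nat (k choose Suc i) \<star> b i)"
    by (subst sum.lessThan_Suc_shift[where n=k]) (simp add: b_def binomial_eq_0)
  also have "\<dots> = (\<Sum>i<Suc k. of_nat (Suc k choose Suc i) \<star> b i)"
    by (simp only: sum.distrib[symmetric] scale_left_distrib[symmetric] of_nat_add[symmetric]
        binomial_Suc_Suc)
  finally show ?case by (simp only: b_def diff_Suc_1)
qed simp

text \<open>
  In the commutator of \<open>W\<^sup>p\<close> with an operator, all binomial coefficients but the last one vanish.
\<close>

lemma W_pow_B_sum_char: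
  assumes "CHAR('f) = p" "p > 0"
  shows "(\<Sum>j<p. (W ^^ j) (B m ((W ^^ (p - 1 - j)) q))) = B ((W ^^ (p - 1)) m) q"
proof -
  obtain k where p: "p = Suc k" using \<open>p > 0\<close> by (cases p) auto
  have "prime p" using assms prime_CHAR_semidom[where 'a='f] by auto
  have z: "of_nat (p choose Suc i) = (0::'f)" if "i < k" for i
  proof -
    have "p dvd (p choose Suc i)" using that p
      by (intro dvd_choose_prime \<open>prime p\<close>) auto
    then show ?thesis using assms(1) of_nat_eq_0_iff_char_dvd by blast
  qed
  have "(\<Sum>i<k. of_nat (p choose Suc i) \<star> B ((W ^^ i) m) ((W ^^ (p - 1 - i)) q)) = 0"
    by (rule sum.neutral) (use z in auto)
  then have "(\<Sum>i<p. of_nat (p choose Suc i) \<star> B ((W ^^ i) m) ((W ^^ (p - 1 - i)) q))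
      = B ((W ^^ (p - 1)) m) q"
    by (simp add: p binomial_eq_0)
  then show ?thesis by (simp only: W_pow_B_sum)
qed

text \<open>
  Modulo \<open>p\<close> the coefficients \<open>binom (p - 1) (i + 1)\<close> are \<open>(-1)\<^sup>i\<^sup>+\<^sup>1\<close>.  Exchanging \<open>u\<close> and \<open>v\<close>
  reverses the order of the terms and flips the sign of \<open>B\<close>; the two effects cancel because
  \<open>(-1)\<^sup>p\<^sup>-\<^sup>1 = 1\<close> in the field, also for \<open>p = 2\<close>.
\<close>

lemma W_pow_B_sum_sym:
  assumes "CHAR('f) = p" "p > 0"
  shows "(\<Sum>j<p-1. (W ^^ j) (B u ((W ^^ (p - 1 - 1 - j)) v))) =
         (\<Sum>j<p-1. (W ^^ j) (B v ((W ^^ (p - 1 - 1 - j)) u)))"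
proof -
  have e: "(\<Sum>j<p-1. (W ^^ j) (B u ((W ^^ (p - 1 - 1 - j)) v))) =
     (\<Sum>i<p-1. ((-1) ^ Suc i :: 'f) \<star> B ((W ^^ i) u) ((W ^^ (p - 1 - 1 - i)) v))" for u v
    unfolding W_pow_B_sum
    by (intro sum.cong refl) (use choose_pred_prime_mod[OF assms] in force)
  have sgn: "((-1) ^ (p - 1) :: 'f) = 1"
    using choose_pred_prime_mod[OF assms, of "p - 1"] by simp
  have "(\<Sum>i<p-1. ((-1) ^ Suc i :: 'f) \<star> B ((W ^^ i) v) ((W ^^ (p - 1 - 1 - i)) u))
      = (\<Sum>i<p-1. ((-1) ^ Suc (p - 1 - Suc i) :: 'f) \<star> B ((W ^^ (p - 1 - Suc i)) v) ((W ^^ (p - 1 - 1 - (p - 1 - Suc i))) u))"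
    by (rule sum.nat_diff_reindex[symmetric])
  also have "\<dots> = (\<Sum>i<p-1. ((-1) ^ Suc i :: 'f) \<star> B ((W ^^ i) u) ((W ^^ (p - 1 - 1 - i)) v))"
  proof (intro sum.cong refl)
    fix i assume "i \<in> {..<p-1}"
    then have i: "i < p - 1" by simp
    have e1: "p - 1 - 1 - (p - 1 - Suc i) = i" and e2: "p - 1 - Suc i = p - 1 - 1 - i"
      using i by auto
    have "((-1) ^ Suc (p - 1 - Suc i) :: 'f) * (-1) ^ i = (-1) ^ (p - 1)"
    proof -
      have "Suc (p - 1 - Suc i) + i = p - 1" using i by simp
      then show ?thesis by (metis power_add)
    qed
    then have "((-1) ^ Suc (p - 1 - Suc i) :: 'f) * (-1) ^ i = 1" using sgn by simp
    then have s: "((-1) ^ Suc (p - 1 - Suc i) :: 'f) = (-1) ^ i"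
      by (metis (no_types) left_minus_one_mult_self mult.commute mult.right_neutral)
    show "((-1) ^ Suc (p - 1 - Suc i) :: 'f) \<star> B ((W ^^ (p - 1 - Suc i)) v) ((W ^^ (p - 1 - 1 - (p - 1 - Suc i))) u)
       = ((-1) ^ Suc i :: 'f) \<star> B ((W ^^ i) u) ((W ^^ (p - 1 - 1 - i)) v)"
      unfolding s e1 unfolding e2 by (subst B_swap) simp
  qed
  finally show ?thesis by (simp only: e)
qed

text \<open>
  The hypothesis says that \<open>\<Delta>\<close> is a derivation with \<open>\<Delta> w = d\<close> if \<open>W\<close> is the bracket with \<open>w\<close>.
  The set \<open>S\<close> allows for a \<open>\<Delta>\<close> that is a derivation on a subspace only.
\<close>

lemma commutator_W_pow:
  assumes S: "\<And>g. g \<in> S \<Longrightarrow> W g \<in> S"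
    and \<Delta>: "\<And>g. g \<in> S \<Longrightarrow> \<Delta> (W g) = W (\<Delta> g) + B d g"
    and g: "g \<in> S"
  shows "\<Delta> ((W ^^ k) g) = (W ^^ k) (\<Delta> g) + (\<Sum>j<k. (W ^^ j) (B d ((W ^^ (k - 1 - j)) g)))"
proof (induction k)
  case (Suc k)
  have gk: "(W ^^ k) g \<in> S" by (induction k) (use g S in auto)
  have "\<Delta> ((W ^^ Suc k) g) = W (\<Delta> ((W ^^ k) g)) + B d ((W ^^ k) g)"
    using \<Delta>[OF gk] by simp
  also have "\<dots> = (W ^^ Suc k) (\<Delta> g) + ((\<Sum>j<k. W ((W ^^ j) (B d ((W ^^ (k - 1 - j)) g)))) + B d ((W ^^ k) g))"
    by (simp add: Suc.IH W_add W_sum)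
  also have "(\<Sum>j<k. W ((W ^^ j) (B d ((W ^^ (k - 1 - j)) g)))) + B d ((W ^^ k) g)
      = (\<Sum>j<Suc k. (W ^^ j) (B d ((W ^^ (Suc k - 1 - j)) g)))"
    by (subst sum.lessThan_Suc_shift) simp
  finally show ?case .
qed simp

text \<open>
  With \<open>W = ad w\<close> and \<open>\<Delta>\<^sub>i w = d\<^sub>i\<close>, the sums that arise when \<open>\<Delta>\<^sub>1\<close> is moved past \<open>W\<^sup>p\<^sup>-\<^sup>1\<close> in
  front of \<open>d\<^sub>2\<close> and \<open>\<Delta>\<^sub>2\<close> in front of \<open>d\<^sub>1\<close> are the same, by the symmetry above.
\<close>

lemma commutator_W_pow_interchange:
  assumes ch: "CHAR('f) = p" "p > 0"
    and S1: "\<And>g. g \<in> S1 \<Longrightarrow> W g \<in> S1" and S2: "\<And>g. g \<in> S2 \<Longrightarrow> W g \<in> S2"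
    and \<Delta>1: "\<And>g. g \<in> S1 \<Longrightarrow> \<Delta>1 (W g) = W (\<Delta>1 g) + B d1 g"
    and \<Delta>2: "\<And>g. g \<in> S2 \<Longrightarrow> \<Delta>2 (W g) = W (\<Delta>2 g) + B d2 g"
    and d: "d2 \<in> S1" "d1 \<in> S2"
  shows "\<Delta>1 ((W ^^ (p - 1)) d2) - (W ^^ (p - 1)) (\<Delta>1 d2)
       = \<Delta>2 ((W ^^ (p - 1)) d1) - (W ^^ (p - 1)) (\<Delta>2 d1)"
  using commutator_W_pow[of S1 \<Delta>1 d1 d2, OF S1 \<Delta>1 d(1), of "p - 1"]
    commutator_W_pow[of S2 \<Delta>2 d2 d1, OF S2 \<Delta>2 d(2), of "p - 1"]
    W_pow_B_sum_sym[OF ch, of d1 d2] by simp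

lemma commutator_W_pow_char:
  assumes ch: "CHAR('f) = p" "p > 0"
    and S: "\<And>g. g \<in> S \<Longrightarrow> W g \<in> S"
    and \<Delta>: "\<And>g. g \<in> S \<Longrightarrow> \<Delta> (W g) = W (\<Delta> g) + B d g"
    and g: "g \<in> S"
  shows "\<Delta> ((W ^^ p) g) = (W ^^ p) (\<Delta> g) + B ((W ^^ (p - 1)) d) g"
  using commutator_W_pow[of S \<Delta> d g, OF S \<Delta> g, of p] W_pow_B_sum_char[OF ch] by simp

end

section \<open>Polynomials over a Lie algebra\<close>

context lie_algebra
begin

lemma bracket_zero_left [simp]: "bracket 0 y = 0"
  using bracket_add_left[of 0 0 y] by simp

lemma bracket_zero_right [simp]: "bracket x 0 = 0"
  using bracket_add_right[of x 0 0] by simp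

lemma bracket_minus_left: "bracket (- x) y = - bracket x y"
  using bracket_add_left[of x "-x" y] by (simp add: eq_neg_iff_add_eq_0 add.commute)

lemma bracket_minus_right: "bracket x (- y) = - bracket x y"
  using bracket_add_right[of x y "-y"] by (simp add: eq_neg_iff_add_eq_0 add.commute)

lemma bracket_diff_left: "bracket (x - y) z = bracket x z - bracket y z"
  using bracket_add_left[of x "-y" z] by (simp add: bracket_minus_left)

lemma bracket_diff_right: "bracket x (y - z) = bracket x y - bracket x z"
  using bracket_add_right[of x y "-z"] by (simp add: bracket_minus_right)

lemma bracket_swap: "bracket x y = - bracket y x"
proof -
  have "bracket (x + y) (x + y) = bracket x y + bracket y x"
    unfolding bracket_add_left bracket_add_right by (simp add: bracket_self)
  then show ?thesis unfolding bracket_self by (metis eq_neg_iff_add_eq_0)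
qed

lemma bracket_leibniz: "bracket x (bracket y z) = bracket (bracket x y) z + bracket y (bracket x z)"
proof -
  have "bracket y (bracket z x) = - bracket y (bracket x z)"
    by (subst bracket_swap[of z x]) (simp add: bracket_minus_right)
  moreover have "bracket z (bracket x y) = - bracket (bracket x y) z"
    by (rule bracket_swap)
  ultimately show ?thesis using jacobi[of x y z] by (simp add: algebra_simps)
qed

lemma bracket_sum_right: "bracket x (\<Sum>i\<in>I. f i) = (\<Sum>i\<in>I. bracket x (f i))"
  by (induction I rule: infinite_finite_induct) (auto simp: bracket_add_right)

lemma leibniz_bracket_ad: "leibniz_bracket scale bracket (ad y)"
proof (unfold_locales, goal_cases)
  case (3 u v) then show ?case by (rule bracket_swap)
next
  case (6 u v) then show ?case by (rule bracket_leibniz)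
qed (simp_all add: bracket_add_left bracket_add_right bracket_scale_right)

lemma ad_pow_zero [simp]: "(ad x ^^ n) 0 = 0"
  by (induction n) auto

lemma ad_pow_add: "(ad x ^^ n) (u + v) = (ad x ^^ n) u + (ad x ^^ n) v"
  by (induction n) (auto simp: bracket_add_right)

lemma ad_pow_scale: "(ad x ^^ n) (c \<cdot> u) = c \<cdot> (ad x ^^ n) u"
  by (induction n) (auto simp: bracket_scale_right)

lemma ad_pow_minus: "(ad x ^^ n) (- u) = - (ad x ^^ n) u"
  by (induction n) (auto simp: bracket_minus_right)

lemma ad_pow_diff: "(ad x ^^ n) (u - v) = (ad x ^^ n) u - (ad x ^^ n) v"
  by (induction n) (auto simp: bracket_diff_right)

lemma ad_pow_scale_left: "(ad (c \<cdot> x) ^^ n) u = c ^ n \<cdot> (ad x ^^ n) u"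
  by (induction n) (auto simp: bracket_scale_left bracket_scale_right)

text \<open>
  A polynomial over \<open>L\<close> is treated as its sequence of coefficients: \<open>conv\<close> is the bracket of
  \<open>L \<otimes> F[X]\<close>, \<open>lin x y\<close> is \<open>x X + y\<close>, and \<open>ad_lin x y\<close> is the bracket with \<open>x X + y\<close>.
\<close>

definition conv :: "(nat \<Rightarrow> 'v) \<Rightarrow> (nat \<Rightarrow> 'v) \<Rightarrow> nat \<Rightarrow> 'v"
  where "conv f g n = (\<Sum>i\<le>n. bracket (f i) (g (n - i)))"

definition lin :: "'v \<Rightarrow> 'v \<Rightarrow> nat \<Rightarrow> 'v"
  where "lin x y n = (case n of 0 \<Rightarrow> y | Suc m \<Rightarrow> if m = 0 then x else 0)"

definition ad_lin :: "'v \<Rightarrow> 'v \<Rightarrow> (nat \<Rightarrow> 'v) \<Rightarrow> nat \<Rightarrow> 'v"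
  where "ad_lin x y g n = (case n of 0 \<Rightarrow> 0 | Suc m \<Rightarrow> bracket x (g m)) + bracket y (g n)"

lemma conv_lin: "conv (lin x y) g = ad_lin x y g"
proof
  fix n show "conv (lin x y) g n = ad_lin x y g n"
  proof (cases n)
    case (Suc m)
    have "conv (lin x y) g n = bracket y (g n) + (\<Sum>i\<le>m. bracket (lin x y (Suc i)) (g (m - i)))"
      unfolding conv_def Suc by (subst sum.atMost_Suc_shift) (simp add: lin_def)
    also have "(\<Sum>i\<le>m. bracket (lin x y (Suc i)) (g (m - i))) = (\<Sum>i\<in>{0}. bracket (lin x y (Suc i)) (g (m - i)))"
      by (rule sum.mono_neutral_right) (auto simp: lin_def)
    also have "\<dots> = bracket x (g m)" by (simp add: lin_def)
    finally show ?thesis by (simp add: ad_lin_def Suc)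
  qed (simp add: conv_def lin_def ad_lin_def)
qed

lemma conv_swap: "conv f g n = - conv g f n"
proof -
  have "conv f g n = (\<Sum>i\<le>n. bracket (f (n - i)) (g i))"
    unfolding conv_def
    by (rule sum.reindex_bij_witness[of _ "\<lambda>i. n - i" "\<lambda>i. n - i"]) auto
  also have "\<dots> = - conv g f n"
    unfolding conv_def sum_negf[symmetric] by (intro sum.cong refl) (rule bracket_swap)
  finally show ?thesis .
qed

lemma ad_lin_conv: "ad_lin x y (conv f g) n = conv (ad_lin x y f) g n + conv f (ad_lin x y g) n"
proof -
  define X where "X h n = (case n of 0 \<Rightarrow> 0 | Suc m \<Rightarrow> bracket x (h m))" for h :: "nat \<Rightarrow> 'v" and n
  have "(case n of 0 \<Rightarrow> 0 | Suc m \<Rightarrow> bracket x (conv f g m))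
      = (\<Sum>i\<le>n. bracket (X f i) (g (n - i))) + (\<Sum>i\<le>n. bracket (f i) (X g (n - i)))"
  proof (cases n)
    case (Suc m)
    have "(\<Sum>i\<le>n. bracket (X f i) (g (n - i))) = (\<Sum>i\<le>m. bracket (bracket x (f i)) (g (m - i)))"
      unfolding Suc by (subst sum.atMost_Suc_shift) (simp add: X_def)
    moreover have "(\<Sum>i\<le>n. bracket (f i) (X g (n - i))) = (\<Sum>i\<le>m. bracket (f i) (bracket x (g (m - i))))"
      unfolding Suc by (simp add: X_def Suc_diff_le)
    ultimately show ?thesis
      by (simp add: Suc conv_def bracket_sum_right bracket_leibniz[of x] sum.distrib)
  qed (simp add: X_def)
  moreover have "bracket y (conv f g n)
      = (\<Sum>i\<le>n. bracket (bracket y (f i)) (g (n - i))) + (\<Sum>i\<le>n. bracket (f i) (bracket y (g (n - i))))"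
    by (simp add: conv_def bracket_sum_right bracket_leibniz[of y] sum.distrib)
  ultimately show ?thesis
    by (simp add: ad_lin_def conv_def bracket_add_left bracket_add_right sum.distrib X_def algebra_simps)
qed

lemma leibniz_bracket_ad_lin: "leibniz_bracket (\<lambda>c f n. c \<cdot> f n) conv (ad_lin x y)"
proof (unfold_locales, goal_cases)
  case (7 u v) then show ?case by (auto simp: fun_eq_iff intro: conv_swap)
next
  case (10 u v) then show ?case by (auto simp: fun_eq_iff ad_lin_conv)
qed (auto simp: fun_eq_iff scale_right_distrib scale_left_distrib conv_def ad_lin_def
  bracket_add_left bracket_add_right bracket_scale_right sum.distrib split: nat.split)

lemma coeff_ad_poly_pow: "coeff ((ad_poly x y ^^ k) [:x:]) = (ad_lin x y ^^ k) (lin 0 x)"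
proof (induction k)
  case 0
  show ?case by (auto simp: fun_eq_iff lin_def coeff_pCons split: nat.split)
next
  case (Suc k)
  show ?case
    unfolding funpow.simps comp_apply Suc.IH[symmetric]
    by (rule ext, subst ad_lin_def) (rule coeff_ad_poly)
qed

text \<open>
  The leading coefficient, the value at \<open>X = 1\<close> and the constant term of a power of
  \<open>ad (x X + y)\<close>, for an argument of degree at most \<open>m\<close>.
\<close>

lemma ad_lin_pow_degree:
  assumes "\<And>n. n > m \<Longrightarrow> f n = 0"
  shows "(\<forall>n>m+k. (ad_lin x y ^^ k) f n = 0) \<and> (ad_lin x y ^^ k) f (m + k) = (ad x ^^ k) (f m)
    \<and> (\<Sum>n\<le>m+k. (ad_lin x y ^^ k) f n) = (ad (x + y) ^^ k) (\<Sum>n\<le>m. f n)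
    \<and> (ad_lin x y ^^ k) f 0 = (ad y ^^ k) (f 0)"
proof (induction k)
  case (Suc k)
  define g where "g = (ad_lin x y ^^ k) f"
  have z: "g n = 0" if "n > m + k" for n using Suc that by (auto simp: g_def)
  have s: "(ad_lin x y ^^ Suc k) f = ad_lin x y g" by (simp add: g_def)
  have "(\<Sum>n\<le>m + Suc k. ad_lin x y g n)
     = (\<Sum>n\<le>m + Suc k. (case n of 0 \<Rightarrow> 0 | Suc m \<Rightarrow> bracket x (g m))) + (\<Sum>n\<le>m + Suc k. bracket y (g n))"
    by (simp add: ad_lin_def sum.distrib)
  also have "(\<Sum>n\<le>m + Suc k. (case n of 0 \<Rightarrow> 0 | Suc m \<Rightarrow> bracket x (g m))) = (\<Sum>n\<le>m+k. bracket x (g n))"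
    by (simp only: add_Suc_right, subst sum.atMost_Suc_shift) simp
  also have "(\<Sum>n\<le>m + Suc k. bracket y (g n)) = (\<Sum>n\<le>m+k. bracket y (g n))"
    by (simp add: z)
  also have "(\<Sum>n\<le>m+k. bracket x (g n)) + (\<Sum>n\<le>m+k. bracket y (g n)) = bracket (x + y) (\<Sum>n\<le>m+k. g n)"
    by (simp add: bracket_add_left bracket_sum_right sum.distrib)
  also have "(\<Sum>n\<le>m+k. g n) = (ad (x + y) ^^ k) (\<Sum>n\<le>m. f n)" using Suc by (simp add: g_def)
  finally have "(\<Sum>n\<le>m + Suc k. ad_lin x y g n) = (ad (x + y) ^^ Suc k) (\<Sum>n\<le>m. f n)" by simp
  moreover have "ad_lin x y g n = 0" if "n > m + Suc k" for n
    using that z by (auto simp: ad_lin_def split: nat.split)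
  moreover have "g (m + k) = (ad x ^^ k) (f m)" "g 0 = (ad y ^^ k) (f 0)"
    using Suc unfolding g_def by blast+
  then have "ad_lin x y g (m + Suc k) = (ad x ^^ Suc k) (f m)"
    "ad_lin x y g 0 = (ad y ^^ Suc k) (f 0)"
    using z by (simp_all add: ad_lin_def)
  ultimately show ?case unfolding s by blast
qed (use assms in auto)

definition lie_ideal :: "'v set \<Rightarrow> bool"
  where "lie_ideal N \<longleftrightarrow> subspace N \<and> (\<forall>u. \<forall>v\<in>N. bracket u v \<in> N)"

lemma lie_idealD:
  assumes "lie_ideal N"
  shows "subspace N" "v \<in> N \<Longrightarrow> bracket u v \<in> N" "v \<in> N \<Longrightarrow> bracket v u \<in> N"
    "v \<in> N \<Longrightarrow> (ad u ^^ k) v \<in> N"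
proof -
  show 1: "subspace N" "v \<in> N \<Longrightarrow> bracket u v \<in> N" for u v using assms by (auto simp: lie_ideal_def)
  show "v \<in> N \<Longrightarrow> bracket v u \<in> N"
    using 1(2)[of v u] 1(1) bracket_swap[of v u] by (simp add: subspace_neg)
  show "v \<in> N \<Longrightarrow> (ad u ^^ k) v \<in> N"
    by (induction k) (auto intro: 1)
qed

definition derivation_on :: "'v set \<Rightarrow> ('v \<Rightarrow> 'v) \<Rightarrow> bool"
  where "derivation_on N D \<longleftrightarrow> (\<forall>u\<in>N. \<forall>v\<in>N. D (u + v) = D u + D v) \<and>
    (\<forall>c. \<forall>u\<in>N. D (c \<cdot> u) = c \<cdot> D u) \<and>
    (\<forall>u\<in>N. \<forall>v\<in>N. D (bracket u v) = bracket (D u) v + bracket u (D v))"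

lemma derivation_onD:
  assumes "derivation_on N D"
  shows "u \<in> N \<Longrightarrow> v \<in> N \<Longrightarrow> D (u + v) = D u + D v"
    "u \<in> N \<Longrightarrow> D (c \<cdot> u) = c \<cdot> D u"
    "u \<in> N \<Longrightarrow> v \<in> N \<Longrightarrow> D (bracket u v) = bracket (D u) v + bracket u (D v)"
    "0 \<in> N \<Longrightarrow> D 0 = 0"
    "u \<in> N \<Longrightarrow> D (- u) = - D u"
proof -
  show *: "u \<in> N \<Longrightarrow> v \<in> N \<Longrightarrow> D (u + v) = D u + D v"
    "u \<in> N \<Longrightarrow> D (c \<cdot> u) = c \<cdot> D u"
    "u \<in> N \<Longrightarrow> v \<in> N \<Longrightarrow> D (bracket u v) = bracket (D u) v + bracket u (D v)" for u v c
    using assms unfolding derivation_on_def by blast+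
  show "0 \<in> N \<Longrightarrow> D 0 = 0" using *(2)[of 0 0] by simp
  show "u \<in> N \<Longrightarrow> D (- u) = - D u" using *(2)[of u "-1"] by simp
qed

lemma derivation_on_sum:
  assumes "derivation_on N D" "subspace N" "\<And>i. i \<in> I \<Longrightarrow> f i \<in> N"
  shows "D (\<Sum>i\<in>I. f i) = (\<Sum>i\<in>I. D (f i))"
  using assms(3)
proof (induction I rule: infinite_finite_induct)
  case (insert i I)
  have "(\<Sum>i\<in>I. f i) \<in> N" using insert.prems by (intro subspace_sum[OF assms(2)]) auto
  then show ?case using insert derivation_onD(1)[OF assms(1)] by simp
qed (use derivation_onD(4)[OF assms(1) subspace_0[OF assms(2)]] in auto)

end

section \<open>The defect of a derivation\<close>

context restricted_lie_algebra
begin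

lemma prime_p: "prime p"
  using char_eq char_pos prime_CHAR_semidom[where 'a='f] by auto

lemma p_ge_2: "p \<ge> 2"
  using prime_p prime_ge_2_nat by blast

lemma pmap_zero [simp]: "pmap 0 = 0"
  using pmap_scale[of 0 0] char_pos by (simp add: zero_power)

lemma ad_pmap_apply: "bracket (pmap x) u = (ad x ^^ p) u"
  using ad_pmap[of x] by simp

lemma ad_pow_p_Suc: "(ad x ^^ p) u = (ad x ^^ (p - 1)) (bracket x u)"
  using char_pos by (metis Suc_diff_1 comp_apply funpow_Suc_right)

lemma ad_pow_p_Suc': "(ad x ^^ p) u = bracket x ((ad x ^^ (p - 1)) u)"
  using char_pos by (metis Suc_diff_1 comp_apply funpow.simps(2))

text \<open>
  The obstruction to \<open>D\<close> being restricted at \<open>y\<close>.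
\<close>

definition defect :: "('v \<Rightarrow> 'v) \<Rightarrow> 'v \<Rightarrow> 'v"
  where "defect D y = D (pmap y) - (ad y ^^ (p - 1)) (D y)"

lemma ad_lin_pow_in_ideal:
  assumes "lie_ideal N" "x \<in> N" "y \<in> N"
  shows "\<forall>n. f n \<in> N \<Longrightarrow> (ad_lin x y ^^ k) f n \<in> N"
proof (induction k arbitrary: n)
  case (Suc k)
  then show ?case
    using assms by (auto simp: ad_lin_def lie_idealD subspace_add subspace_0 split: nat.split)
qed simp

lemma jacobson_s_in_ideal:
  assumes "lie_ideal N" "x \<in> N" "y \<in> N"
  shows "jacobson_s p i x y \<in> N"
  unfolding jacobson_s_def coeff_ad_poly_pow
  using assms lie_idealD(1)[OF assms(1)]
  by (intro subspace_scale ad_lin_pow_in_ideal) (auto simp: lin_def subspace_0 split: nat.split)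

text \<open>
  Put \<open>w = x X + y\<close>.  Jacobson's polynomial \<open>\<Sum> s\<^sub>i X\<^sup>i\<close> has derivative \<open>(ad w)\<^sup>p\<^sup>-\<^sup>1 x\<close>, where
  \<open>x = dw/dX\<close>.  Interchanging \<open>D\<close> and \<open>d/dX\<close> identifies \<open>D\<close> of this derivative with the derivative of
  \<open>(ad w)\<^sup>p\<^sup>-\<^sup>1 (D w)\<close>; in the degrees from \<open>1\<close> to \<open>p - 1\<close> coefficients are determined by the
  derivative.
\<close>

lemma derivation_jacobson_s:
  assumes N: "lie_ideal N" and D: "derivation_on N D" and xy: "x \<in> N" "y \<in> N"
    and i: "1 \<le> i" "i \<le> p - 1"
  shows "D (jacobson_s p i x y) = (ad_lin x y ^^ (p - 1)) (lin (D x) (D y)) i"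
proof -
  interpret F: leibniz_bracket "\<lambda>c f n. c \<cdot> f n" conv "ad_lin x y" by (rule leibniz_bracket_ad_lin)
  define d where "d g n = of_nat (n + 1) \<cdot> g (n + 1)" for g :: "nat \<Rightarrow> 'v" and n
  define G where "G = (ad_lin x y ^^ (p - 1)) (lin (D x) (D y))"
  define S where "S = {g :: nat \<Rightarrow> 'v. \<forall>n. g n \<in> N}"
  have 0: "0 \<in> N" using lie_idealD(1)[OF N] subspace_0 by blast
  have "(\<lambda>n. D ((ad_lin x y ^^ (p - 1)) (lin 0 x) n)) - (ad_lin x y ^^ (p - 1)) (\<lambda>n. D (lin 0 x n))
      = d ((ad_lin x y ^^ (p - 1)) (lin (D x) (D y))) - (ad_lin x y ^^ (p - 1)) (d (lin (D x) (D y)))"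
  proof (rule F.commutator_W_pow_interchange[of p S UNIV "\<lambda>g n. D (g n)" _ d _, OF char_eq char_pos])
    fix g assume g: "g \<in> S"
    then show "ad_lin x y g \<in> S" using ad_lin_pow_in_ideal[OF N xy, of g 1] by (auto simp: S_def)
    show "(\<lambda>n. D (ad_lin x y g n)) = ad_lin x y (\<lambda>n. D (g n)) + conv (lin (D x) (D y)) g"
      using g xy N 0
      by (auto simp: fun_eq_iff conv_lin S_def ad_lin_def derivation_onD[OF D] lie_idealD
          split: nat.split)
  next
    fix g :: "nat \<Rightarrow> 'v"
    have two: "2 \<cdot> v = v + v" for v
      by (metis one_add_one scale_left_distrib scale_one)
    have "d (ad_lin x y g) n = ad_lin x y (d g) n + conv (lin 0 x) g n" for n
      by (cases n) (auto simp: d_def ad_lin_def conv_lin bracket_scale_right bracket_add_right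
          scale_left_distrib scale_right_distrib two)
    then show "d (ad_lin x y g) = ad_lin x y (d g) + conv (lin 0 x) g" by auto
  qed (use xy 0 in \<open>auto simp: S_def lin_def split: nat.split\<close>)
  moreover have "(\<lambda>n. D (lin 0 x n)) = d (lin (D x) (D y))"
    using derivation_onD(4)[OF D 0] by (auto simp: fun_eq_iff lin_def d_def split: nat.split)
  ultimately have *: "(\<lambda>n. D ((ad_lin x y ^^ (p - 1)) (lin 0 x) n)) = d G"
    by (simp add: G_def)
  have nz: "(of_nat i :: 'f) \<noteq> 0"
    using i char_eq char_pos by (auto simp: of_nat_eq_0_iff_char_dvd dest: dvd_imp_le)
  have c: "(ad_lin x y ^^ (p - 1)) (lin 0 x) (i - 1) \<in> N"
    using xy 0 by (intro ad_lin_pow_in_ideal[OF N xy]) (auto simp: lin_def split: nat.split)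
  have "D (jacobson_s p i x y) = inverse (of_nat i) \<cdot> D ((ad_lin x y ^^ (p - 1)) (lin 0 x) (i - 1))"
    unfolding jacobson_s_def coeff_ad_poly_pow by (rule derivation_onD(2)[OF D c])
  also have "\<dots> = inverse (of_nat i) \<cdot> d G (i - 1)"
    using fun_cong[OF *, of "i - 1"] by simp
  also have "\<dots> = G i" using i nz by (simp add: d_def)
  finally show ?thesis by (simp add: G_def)
qed

text \<open>
  The value of \<open>(ad w)\<^sup>p\<^sup>-\<^sup>1 (D w)\<close> at \<open>X = 1\<close> is the sum of its coefficients.  Those of degree \<open>0\<close>
  and \<open>p\<close> are the correction terms of \<open>y\<close> and \<open>x\<close>, the others are the \<open>D s\<^sub>i\<close>.
\<close>

lemma defect_add:
  assumes N: "lie_ideal N" and D: "derivation_on N D" and xy: "x \<in> N" "y \<in> N"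
    and pN: "pmap x \<in> N" "pmap y \<in> N"
  shows "defect D (x + y) = defect D x + defect D y"
proof -
  note sN = lie_idealD(1)[OF N]
  define G where "G = (ad_lin x y ^^ (p - 1)) (lin (D x) (D y))"
  have lin0: "lin (D x) (D y) n = 0" if "n > 1" for n
    using that by (auto simp: lin_def split: nat.split)
  have p1: "1 + (p - 1) = p" using char_pos by simp
  have G: "G p = (ad x ^^ (p - 1)) (D x)" "G 0 = (ad y ^^ (p - 1)) (D y)"
    "(\<Sum>n\<le>p. G n) = (ad (x + y) ^^ (p - 1)) (D x + D y)"
    using ad_lin_pow_degree[where f="lin (D x) (D y)" and m=1 and k="p-1" and x=x and y=y, OF lin0]
    unfolding p1 by (auto simp: G_def lin_def add.commute)
  have js: "(\<Sum>i = 1..p - 1. jacobson_s p i x y) \<in> N"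
    by (intro subspace_sum sN jacobson_s_in_ideal N xy)
  have "D (\<Sum>i = 1..p - 1. jacobson_s p i x y) = (\<Sum>i = 1..p - 1. G i)"
    using derivation_on_sum[OF D sN, of "{1..p-1}" "\<lambda>i. jacobson_s p i x y"]
    by (simp add: jacobson_s_in_ideal[OF N xy] derivation_jacobson_s[OF N D xy] G_def)
  moreover have "(\<Sum>n\<le>p. G n) = G 0 + (\<Sum>i = 1..p - 1. G i) + G p"
  proof -
    have "{..p} = insert 0 (insert p {1..p-1})" using char_pos by auto
    then show ?thesis using char_pos by (simp add: algebra_simps)
  qed
  moreover have "D (pmap (x + y)) = D (pmap x) + D (pmap y) + D (\<Sum>i = 1..p - 1. jacobson_s p i x y)"
    unfolding pmap_add using sN pN js by (simp add: derivation_onD[OF D] subspace_add)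
  moreover have "D (x + y) = D x + D y" using xy derivation_onD(1)[OF D] by blast
  ultimately show ?thesis by (simp add: defect_def G algebra_simps)
qed

lemma defect_scale:
  assumes "lie_ideal N" and D: "derivation_on N D" and "x \<in> N" "pmap x \<in> N"
  shows "defect D (c \<cdot> x) = c ^ p \<cdot> defect D x"
proof -
  have "c ^ p = c ^ (p - 1) * c" using char_pos by (metis Suc_diff_1 power_Suc2)
  then show ?thesis using assms
    by (simp add: defect_def pmap_scale derivation_onD[OF D] ad_pow_scale_left ad_pow_scale
        scale_right_diff_distrib)
qed

text \<open>
  The commutator of \<open>D\<close> with \<open>ad x\<close> remains restricted when \<open>D\<close> has a defect that \<open>x\<close> kills.  This
  is what permits the defects in the construction of \<open>exists_retraction_derivation\<close>.
\<close>

lemma defect_commutator: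
  assumes N: "lie_ideal N" and D: "derivation_on N D" and y: "y \<in> N" "pmap y \<in> N"
    and c: "bracket x (defect D y) = 0"
  shows "defect (\<lambda>u. bracket x (D u) - D (bracket x u)) y = 0"
proof -
  interpret F: leibniz_bracket scale bracket "ad y" by (rule leibniz_bracket_ad)
  have i: "D ((ad y ^^ (p - 1)) (bracket x y)) - (ad y ^^ (p - 1)) (D (bracket x y))
      = bracket x ((ad y ^^ (p - 1)) (D y)) - (ad y ^^ (p - 1)) (bracket x (D y))"
    by (rule F.commutator_W_pow_interchange[where ?\<Delta>1.0=D and ?\<Delta>2.0="ad x" and ?S1.0=N and ?S2.0=UNIV and ?d1.0="D y" and ?d2.0="bracket x y", OF char_eq char_pos])
      (use y in \<open>auto simp: lie_idealD[OF N] derivation_onD[OF D] bracket_leibniz[of x]\<close>)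
  have "bracket x (pmap y) = (ad y ^^ (p - 1)) (bracket x y)"
    using ad_pmap_apply[of y x] ad_pow_p_Suc[of y x]
    by (subst bracket_swap, subst bracket_swap[of x y]) (simp add: ad_pow_minus)
  moreover have "bracket x (D (pmap y)) = bracket x ((ad y ^^ (p - 1)) (D y))"
    using c by (simp add: defect_def bracket_diff_right)
  ultimately show ?thesis using i by (simp add: defect_def ad_pow_diff algebra_simps)
qed

end

section \<open>Linear forms and the abelian case\<close>

context vector_space
begin

lemma exists_functional:
  assumes S: "subspace S" and x: "x \<notin> S"
  obtains l :: "'b \<Rightarrow> 'a" where "\<And>u v. l (u + v) = l u + l v" "\<And>c u. l (scale c u) = c * l u"
    "\<And>v. v \<in> S \<Longrightarrow> l v = 0" "l x = 1"
proof -
  interpret vp: vector_space_pair scale "(*) :: 'a \<Rightarrow> 'a \<Rightarrow> 'a"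
    by unfold_locales (auto simp: algebra_simps)
  obtain B where B: "B \<subseteq> S" "independent B" "S \<subseteq> span B"
    using maximal_independent_subset by blast
  have sB: "span B = S" using B S by (simp add: span_minimal subset_antisym)
  then have xB: "x \<notin> B" "independent (insert x B)" using B x by (auto simp: independent_insert span_base)
  obtain l where l: "Vector_Spaces.linear scale (*) l" "\<forall>b\<in>insert x B. l b = (if b = x then 1 else 0)"
    using vp.linear_independent_extend[OF xB(2), of "\<lambda>b. if b = x then 1 else 0"] by blast
  have lB: "l b = 0" if "b \<in> B" for b
    using bspec[OF l(2), of b] that xB(1) by auto
  have "l v = 0" if "v \<in> S" for v
    using vp.linear_eq_0_on_span[OF l(1), of B v] lB that sB by blast
  with l vp.linear_add[OF l(1)] vp.linear_scale[OF l(1)] show ?thesis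
    by (intro that[of l]) auto
qed

end

context lie_algebra
begin

lemma bracket_in_lower_central: "v \<in> lower_central n \<Longrightarrow> bracket u v \<in> lower_central (Suc n)"
  by (auto intro: span_base)

lemma subspace_lower_central: "subspace (lower_central n)"
  by (cases n) auto

lemma lower_central_Suc_subset: "lower_central (Suc n) \<subseteq> lower_central n"
proof (induction n)
  case (Suc n)
  then show ?case unfolding lower_central.simps(2)[of "Suc n"] lower_central.simps(2)[of n]
    by (intro span_mono) auto
qed auto

lemma lower_central_mono: "m \<le> n \<Longrightarrow> lower_central n \<subseteq> lower_central m"
  using lower_central_Suc_subset by (rule lift_Suc_antimono_le)

lemma ad_pow_in_lower_central: "(ad x ^^ n) v \<in> lower_central n"
proof (induction n)
  case (Suc n)
  then show ?case using bracket_in_lower_central by simp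
qed simp

lemma linear_derivation_iff:
  "derivation D \<longleftrightarrow> derivation_on UNIV D"
proof -
  show ?thesis
    unfolding derivation_def derivation_on_def Vector_Spaces.linear_iff
    using vector_space_axioms by auto
qed

definition centralizer :: "'v set \<Rightarrow> 'v set"
  where "centralizer S = {v. \<forall>u\<in>S. bracket u v = 0}"

definition center :: "'v set"
  where "center = centralizer UNIV"

lemma centerD: "z \<in> center \<Longrightarrow> bracket u z = 0" "z \<in> center \<Longrightarrow> bracket z u = 0"
  by (auto simp: center_def centralizer_def bracket_swap[of z u])

lemma lie_ideal_derived: "lie_ideal (span {bracket u v | u v. True})"
  unfolding lie_ideal_def by (auto intro: span_base)

end

context restricted_lie_algebra
begin

text \<open>
  As \<open>z\<close> commutes with the kernel of \<open>l\<close>, each \<open>ad y\<close> acts on the elements \<open>(ad x)\<^sup>k z\<close> as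
  \<open>l y\<close> times \<open>ad x\<close>.  This reduces restrictedness to the single condition on \<open>x\<close>.
\<close>

lemma functional_derivation:
  assumes add: "\<And>u v. l (u + v) = l u + l v" and scale: "\<And>c u. l (c \<cdot> u) = c * l u"
    and br: "\<And>u v. l (bracket u v) = 0" and pm: "\<And>u. l (pmap u) = 0"
    and x: "l x = 1" and z: "l z = 0" "\<And>i. l i = 0 \<Longrightarrow> bracket i z = 0"
      "(ad x ^^ (p - 1)) z = 0"
  shows "restricted_derivation (\<lambda>v. l v \<cdot> z)" "(\<lambda>v. l v \<cdot> z) \<circ> (\<lambda>v. l v \<cdot> z) = (\<lambda>v. 0)"
proof -
  have split: "bracket y w = l y \<cdot> bracket x w" if "\<And>i. l i = 0 \<Longrightarrow> bracket i w = 0" for y w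
  proof -
    have "l (y - l y \<cdot> x) = 0"
      using add[of "y - l y \<cdot> x" "l y \<cdot> x"] scale x by simp
    then have "bracket (y - l y \<cdot> x) w = 0" by (rule that)
    then show ?thesis by (simp add: bracket_diff_left bracket_scale_left)
  qed
  have pow: "(ad y ^^ k) z = l y ^ k \<cdot> (ad x ^^ k) z \<and> (\<forall>i. l i = 0 \<longrightarrow> bracket i ((ad x ^^ k) z) = 0)" for y k
  proof (induction k)
    case (Suc k)
    have "bracket i (bracket x ((ad x ^^ k) z)) = 0" if "l i = 0" for i
      using Suc that br[of i x] z by (subst bracket_leibniz) (simp add: Suc br split[of _ "bracket i x"])
    then show ?case using Suc split[of "(ad x ^^ k) z" y]
      by (simp add: bracket_scale_right mult.commute)
  qed (use z in auto)
  have "derivation (\<lambda>v. l v \<cdot> z)"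
    unfolding linear_derivation_iff derivation_on_def
  proof (intro conjI ballI allI)
    fix u v
    have "bracket u z = l u \<cdot> bracket x z" "bracket z v = - (l v \<cdot> bracket x z)"
      using split[OF z(2), of u] split[OF z(2), of v] bracket_swap[of z v] by simp_all
    then show "l (bracket u v) \<cdot> z = bracket (l u \<cdot> z) v + bracket u (l v \<cdot> z)"
      by (simp add: br bracket_scale_left bracket_scale_right mult.commute)
  qed (auto simp: add scale scale_left_distrib)
  moreover have "(ad y ^^ (p - 1)) (l y \<cdot> z) = 0" for y
    using pow[where y=y and k="p-1"] z by (simp add: ad_pow_scale)
  ultimately show "restricted_derivation (\<lambda>v. l v \<cdot> z)"
    by (simp add: restricted_derivation_def pm)
  show "(\<lambda>v. l v \<cdot> z) \<circ> (\<lambda>v. l v \<cdot> z) = (\<lambda>v. 0)"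
    by (auto simp: scale z)
qed

lemma pmap_add_abelian:
  assumes abelian shows "pmap (u + v) = pmap u + pmap v"
proof -
  have "ad_lin x y g n = 0" for x y g n
    using assms by (auto simp: ad_lin_def abelian_def split: nat.split)
  then have "(ad_lin u v ^^ (p - 1)) (lin 0 u) n = 0" for n
    using p_ge_2 by (cases "p - 1") auto
  then show ?thesis
    by (simp add: pmap_add jacobson_s_def coeff_ad_poly_pow)
qed

end

locale nilpotent_restricted_lie_algebra =
  restricted_lie_algebra scale bracket p pmap + finite_dimensional_vector_space scale Basis
  for scale :: "'f::field \<Rightarrow> 'v::ab_group_add \<Rightarrow> 'v" (infixr \<open>\<cdot>\<close> 75)
    and bracket p pmap Basis +
  assumes nilpotent: nilpotent
begin

lemma lower_central_eventually_zero: "\<exists>c. \<forall>n\<ge>c. lower_central n = {0}"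
proof -
  obtain c where c: "lower_central c = {0}" using nilpotent unfolding nilpotent_def by blast
  have "lower_central n = {0}" if "n \<ge> c" for n
    using lower_central_mono[OF that] c subspace_0[OF subspace_lower_central[of n]] by auto
  then show ?thesis by blast
qed

text \<open>
  Nilpotency in the form in which it is used: a nonzero image of an ideal contains a nonzero element
  that is central modulo \<open>N\<close>.  Any element of \<open>S\<close> outside \<open>N\<close> that is as deep as possible in the
  lower central series will do.
\<close>

lemma ideal_step:
  assumes S: "lie_ideal S" "\<not> S \<subseteq> N" and N: "0 \<in> N"
  obtains v where "v \<in> S" "v \<notin> N" "\<And>u. bracket u v \<in> N"
proof -
  define P where "P n \<longleftrightarrow> S \<inter> lower_central n \<subseteq> N" for n
  obtain c where "lower_central c = {0}" using lower_central_eventually_zero by blast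
  then have "P c" using N by (auto simp: P_def)
  then have L: "P (LEAST n. P n)" by (rule LeastI)
  have "\<not> P 0" using S by (simp add: P_def)
  with L obtain m where m: "(LEAST n. P n) = Suc m" by (cases "LEAST n. P n") auto
  with L have L: "S \<inter> lower_central (Suc m) \<subseteq> N" by (simp only: P_def)
  have "\<not> P m" using m not_less_Least[of m P] by simp
  then obtain v where v: "v \<in> S" "v \<in> lower_central m" "v \<notin> N" by (auto simp: P_def)
  have "bracket u v \<in> N" for u
    by (rule subsetD[OF L IntI[OF lie_idealD(2)[OF S(1) v(1)] bracket_in_lower_central[OF v(2)]]])
  then show ?thesis using that[OF v(1,3)] by blast
qed

text \<open>
  On an abelian algebra the \<open>p\<close>-map is semilinear; if its values span, it turns independent families
  into independent families.  A \<open>p\<close>-subalgebra \<open>H\<close> with \<open>x\<^sup>[\<^sup>p\<^sup>] \<in> H\<close> contains the \<open>p\<close>-th powers of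
  \<open>H + F x\<close>, so that \<open>H + F x\<close> has no larger dimension than \<open>H\<close>.
\<close>

lemma torus_if_abelian_span_pmap:
  assumes ab: abelian and sp: "span (range pmap) = UNIV"
  shows torus
proof -
  have "semisimple x" for x
  proof -
    have "x \<in> H" if H: "p_subalgebra H" "pmap x \<in> H" for H
    proof (rule ccontr)
      assume x: "x \<notin> H"
      have sH: "subspace H" and pH: "\<And>h. h \<in> H \<Longrightarrow> pmap h \<in> H"
        using H by (auto simp: p_subalgebra_def)
      obtain C where C: "C \<subseteq> H" "independent C" "H \<subseteq> span C" "card C = dim H"
        using basis_exists by blast
      have "x \<notin> span C" using x C(1) sH span_minimal by blast
      then have xC: "x \<notin> C" "independent (insert x C)" using C by (auto simp: independent_insert span_base)
      define B where "B = extend_basis (insert x C)"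
      have B: "insert x C \<subseteq> B" "independent B" "span B = UNIV"
        unfolding B_def using extend_basis_superset[OF xC(2)] independent_extend_basis[OF xC(2)]
          span_extend_basis[OF xC(2)] by auto
      have fB: "finite B" using B(2) finiteI_independent by blast
      have "subspace {v. pmap v \<in> span (pmap ` B)}"
        by (auto simp: subspace_def pmap_add_abelian[OF ab] pmap_scale span_add span_scale span_zero)
      then have "span B \<subseteq> {v. pmap v \<in> span (pmap ` B)}"
        by (intro span_minimal) (auto intro: span_base)
      then have "range pmap \<subseteq> span (pmap ` B)" using B(3) by auto
      then have spB: "span (pmap ` B) = UNIV"
        using sp span_minimal[of "range pmap" "span (pmap ` B)"] by auto
      have cB: "card B = dim (UNIV :: 'v set)" using B basis_card_eq_dim[of B UNIV] by auto
      have "dim (UNIV :: 'v set) \<le> card (pmap ` B)"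
        using spB fB by (intro dim_le_card) auto
      then have c: "card (pmap ` B) = card B" using card_image_le[OF fB, of pmap] cB by simp
      then have inj: "inj_on pmap B" using fB by (simp add: eq_card_imp_inj_on)
      have "independent (pmap ` B)"
        using spB fB c cB by (intro card_le_dim_spanning[of _ UNIV]) auto
      then have "independent (pmap ` insert x C)" by (rule independent_mono) (use B in auto)
      moreover have "pmap ` insert x C \<subseteq> H" using C pH H by auto
      ultimately have "card (pmap ` insert x C) \<le> dim H"
        by (metis independent_card_le_dim)
      moreover have "card (pmap ` insert x C) = Suc (dim H)"
        using xC(1) C finiteI_independent[OF C(2)] card_image[OF inj_on_subset[OF inj B(1)]] by simp
      ultimately show False by simp
    qed
    then show ?thesis by (auto simp: semisimple_def hull_def)
  qed
  with ab show ?thesis by (simp add: torus_def)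
qed

lemma abelian_case:
  assumes ab: abelian and nt: "\<not> torus" and dim: "dim (UNIV :: 'v set) > 1"
  shows "\<exists>D. outer_restricted_derivation D \<and> D \<circ> D = (\<lambda>x. 0)"
proof -
  obtain x where "x \<notin> span (range pmap)" using torus_if_abelian_span_pmap[OF ab] nt by auto
  then obtain l where l: "\<And>u v. l (u + v) = l u + l v" "\<And>c u. l (c \<cdot> u) = c * l u"
    "\<And>v. v \<in> span (range pmap) \<Longrightarrow> l v = 0" "l x = 1"
    using exists_functional[OF subspace_span] by metis
  have l0: "l 0 = 0" using l(2)[of 0 0] by simp
  have ab0: "bracket u v = 0" for u v using ab by (simp add: abelian_def)
  have "\<exists>z. z \<noteq> 0 \<and> l z = 0"
  proof (rule ccontr)
    assume n: "\<not> ?thesis"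
    have "v \<in> span {x}" for v
    proof -
      have "l (v - l v \<cdot> x) = 0" using l(1)[of "v - l v \<cdot> x" "l v \<cdot> x"] l(2,4) by simp
      then have "v - l v \<cdot> x = 0" using n by blast
      then have "v = l v \<cdot> x" by simp
      then show ?thesis by (metis insertI1 span_base span_scale)
    qed
    then have "dim (UNIV :: 'v set) \<le> card {x}" by (intro dim_le_card) auto
    then show False using dim by simp
  qed
  then obtain z where z: "z \<noteq> 0" "l z = 0" by blast
  have pz: "(ad x ^^ (p - 1)) z = 0" using p_ge_2 by (cases "p - 1") (auto simp: ab0)
  have lp: "l (pmap u) = 0" for u by (rule l(3)) (simp add: span_base)
  note fd = functional_derivation[of l x z, OF l(1,2) _ lp l(4) z(2) _ pz]
  have "restricted_derivation (\<lambda>v. l v \<cdot> z)" "(\<lambda>v. l v \<cdot> z) \<circ> (\<lambda>v. l v \<cdot> z) = (\<lambda>v. 0)"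
    using fd by (simp_all add: ab0 l0)
  moreover have "\<not> inner_derivation (\<lambda>v. l v \<cdot> z)"
  proof
    assume "inner_derivation (\<lambda>v. l v \<cdot> z)"
    then obtain a where "(\<lambda>v. l v \<cdot> z) = ad a" unfolding inner_derivation_def by blast
    then have "l x \<cdot> z = bracket a x" by metis
    then show False using z l(4) by (simp add: ab0)
  qed
  ultimately show ?thesis unfolding outer_restricted_derivation_def by blast
qed

end

section \<open>Self-centralizing ideals\<close>

context lie_algebra
begin

definition adjoin :: "'v set \<Rightarrow> 'v \<Rightarrow> 'v set"
  where "adjoin N x = {v. \<exists>t. v - t \<cdot> x \<in> N}"

lemma adjoin_functional:
  assumes N: "subspace N" and x: "x \<notin> N"
  obtains l where "\<And>u v. l (u + v) = l u + l v" "\<And>c u. l (c \<cdot> u) = c * l u"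
    "\<And>v. v \<in> N \<Longrightarrow> l v = 0" "l x = 1" "\<And>v. v \<in> adjoin N x \<Longrightarrow> v - l v \<cdot> x \<in> N"
proof -
  obtain l where l: "\<And>u v. l (u + v) = l u + l v" "\<And>c u. l (c \<cdot> u) = c * l u"
    "\<And>v. v \<in> N \<Longrightarrow> l v = 0" "l x = 1"
    using exists_functional[OF N x] by metis
  have "v - l v \<cdot> x \<in> N" if "v \<in> adjoin N x" for v
  proof -
    from that obtain t where t: "v - t \<cdot> x \<in> N" by (auto simp: adjoin_def)
    then have "l v = t" using l(1)[of "v - t \<cdot> x" "t \<cdot> x"] l(2)[of t x] l(3)[OF t] l(4) by simp
    with t show ?thesis by simp
  qed
  with l that show ?thesis by blast
qed

lemma adjoin_lie_ideal:
  assumes N: "lie_ideal N" and x: "\<And>u. bracket u x \<in> N"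
  shows "lie_ideal (adjoin N x)" "N \<subseteq> adjoin N x" "x \<in> adjoin N x"
    "v \<in> adjoin N x \<Longrightarrow> bracket u v \<in> N"
proof -
  note sN = lie_idealD(1)[OF N]
  show sub: "N \<subseteq> adjoin N x" unfolding adjoin_def by (auto intro: exI[of _ 0])
  show "x \<in> adjoin N x" using subspace_0[OF sN] unfolding adjoin_def by (auto intro!: exI[of _ 1])
  show br: "v \<in> adjoin N x \<Longrightarrow> bracket u v \<in> N" for u v
  proof -
    assume "v \<in> adjoin N x"
    then obtain t where t: "v - t \<cdot> x \<in> N" by (auto simp: adjoin_def)
    have "bracket u v = bracket u (v - t \<cdot> x) + t \<cdot> bracket u x"
      by (simp add: bracket_diff_right bracket_scale_right)
    then show ?thesis using t x sN lie_idealD(2)[OF N] by (simp add: subspace_add subspace_scale)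
  qed
  have "subspace (adjoin N x)"
    unfolding subspace_def
  proof (intro conjI ballI allI)
    show "0 \<in> adjoin N x" using sub subspace_0[OF sN] by blast
  next
    fix u v assume "u \<in> adjoin N x" "v \<in> adjoin N x"
    then obtain s t where "u - s \<cdot> x \<in> N" "v - t \<cdot> x \<in> N" by (auto simp: adjoin_def)
    then have "(u - s \<cdot> x) + (v - t \<cdot> x) \<in> N" by (rule subspace_add[OF sN])
    moreover have "(u - s \<cdot> x) + (v - t \<cdot> x) = (u + v) - (s + t) \<cdot> x" by (simp add: scale_left_distrib)
    ultimately show "u + v \<in> adjoin N x" by (auto simp: adjoin_def)
  next
    fix c u assume "u \<in> adjoin N x"
    then obtain s where "u - s \<cdot> x \<in> N" by (auto simp: adjoin_def)
    then have "c \<cdot> (u - s \<cdot> x) \<in> N" by (rule subspace_scale[OF sN])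
    then have "c \<cdot> u - (c * s) \<cdot> x \<in> N" by (simp add: scale_right_diff_distrib)
    then show "c \<cdot> u \<in> adjoin N x" by (auto simp: adjoin_def)
  qed
  then show "lie_ideal (adjoin N x)" using br sub unfolding lie_ideal_def by blast
qed

lemma centralizer_swap: "v \<in> centralizer S \<Longrightarrow> u \<in> S \<Longrightarrow> bracket v u = 0"
  unfolding centralizer_def using bracket_swap[of v u] by auto

lemma lie_ideal_centralizer:
  assumes "lie_ideal N" shows "lie_ideal (centralizer N)"
proof -
  have "bracket v (bracket u c) = 0" if "c \<in> centralizer N" "v \<in> N" for u v c
    using that lie_idealD(3)[OF assms, of v u] by (subst bracket_leibniz) (auto simp: centralizer_def)
  moreover have "subspace (centralizer N)"
    by (auto simp: subspace_def centralizer_def bracket_add_right bracket_scale_right)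
  ultimately show ?thesis by (auto simp: lie_ideal_def centralizer_def)
qed

end

context nilpotent_restricted_lie_algebra
begin

lemma dim_psubset_subspace:
  assumes "subspace S" "subspace T" "S \<subset> T"
  shows "dim S < dim T"
proof -
  have "span S = S" "span T = T" using assms by (simp_all add: span_eq_iff)
  with assms(3) have "span S \<subset> span T" by metis
  then show ?thesis by (rule dim_psubset)
qed

text \<open>
  An abelian ideal of maximal dimension is its own centralizer: otherwise its centralizer contains an
  element that is central modulo the ideal, and adjoining it gives a larger abelian ideal.
\<close>

lemma exists_self_centralizing_ideal: "\<exists>A. lie_ideal A \<and> centralizer A = A"
proof -
  define P where "P A \<longleftrightarrow> lie_ideal A \<and> A \<subseteq> centralizer A" for A
  have "P {0}" by (auto simp: P_def lie_ideal_def centralizer_def)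
  moreover have "\<forall>A. P A \<longrightarrow> dim A < Suc dimension" using dim_subset_UNIV by (auto simp: less_Suc_eq_le)
  ultimately obtain A where A: "P A" "\<And>A'. P A' \<Longrightarrow> dim A' \<le> dim A"
    using ex_has_greatest_nat[of P "{0}" dim "Suc dimension"] by blast
  have iA: "lie_ideal A" and sA: "A \<subseteq> centralizer A" using A(1) by (auto simp: P_def)
  note ssA = lie_idealD(1)[OF iA]
  have "centralizer A \<subseteq> A"
  proof (rule ccontr)
    assume "\<not> ?thesis"
    then obtain c where c: "c \<in> centralizer A" "c \<notin> A" "\<And>u. bracket u c \<in> A"
      using ideal_step[OF lie_ideal_centralizer[OF iA]] subspace_0[OF ssA] by metis
    note adj = adjoin_lie_ideal[OF iA c(3)]
    have "adjoin A c \<subseteq> centralizer (adjoin A c)"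
    proof
      fix v assume "v \<in> adjoin A c"
      then obtain t where t: "v - t \<cdot> c \<in> A" by (auto simp: adjoin_def)
      have "bracket u v = 0" if "u \<in> adjoin A c" for u
      proof -
        from that obtain s where s: "u - s \<cdot> c \<in> A" by (auto simp: adjoin_def)
        have "bracket u v = bracket ((u - s \<cdot> c) + s \<cdot> c) ((v - t \<cdot> c) + t \<cdot> c)" by simp
        also have "\<dots> = bracket (u - s \<cdot> c) (v - t \<cdot> c) + t \<cdot> bracket (u - s \<cdot> c) c
          + s \<cdot> bracket c (v - t \<cdot> c)"
          by (simp only: bracket_add_left bracket_add_right bracket_scale_left bracket_scale_right
              bracket_self scale_zero_right add_0_right add_0_left ac_simps)
        also have "\<dots> = 0"
          using s t sA c(1) centralizer_swap[OF c(1) t] by (auto simp: centralizer_def bracket_self)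
        finally show ?thesis .
      qed
      then show "v \<in> centralizer (adjoin A c)" by (simp add: centralizer_def)
    qed
    with adj have "P (adjoin A c)" by (simp add: P_def)
    then have "dim (adjoin A c) \<le> dim A" by (rule A)
    moreover have "dim A < dim (adjoin A c)"
      using adj c(2) ssA by (intro dim_psubset_subspace) (auto simp: lie_idealD)
    ultimately show False by simp
  qed
  with sA iA show ?thesis by blast
qed

end

locale self_centralizing_ideal =
  nilpotent_restricted_lie_algebra scale bracket p pmap Basis
  for scale :: "'f::field \<Rightarrow> 'v::ab_group_add \<Rightarrow> 'v" (infixr \<open>\<cdot>\<close> 75)
    and bracket p pmap Basis +
  fixes A :: "'v set"
  assumes A_ideal: "lie_ideal A" and centralizer_A: "centralizer A = A"
begin

lemma A_abelian: "a \<in> A \<Longrightarrow> b \<in> A \<Longrightarrow> bracket a b = 0"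
  using centralizer_A unfolding centralizer_def by blast

lemma A_centralizing: "(\<And>a. a \<in> A \<Longrightarrow> bracket a v = 0) \<Longrightarrow> v \<in> A"
  using centralizer_A unfolding centralizer_def by blast

lemma subspace_A: "subspace A"
  using A_ideal lie_idealD by blast

lemma zero_in_A: "0 \<in> A"
  using subspace_A subspace_0 by blast

lemma center_subset_A: "center \<subseteq> A"
  using A_centralizing centerD by blast

lemma centralizer_subset_A: "A \<subseteq> N \<Longrightarrow> centralizer N \<subseteq> A"
  using A_centralizing unfolding centralizer_def by blast

lemma pmap_A_central:
  assumes "a \<in> A" shows "pmap a \<in> center"
proof -
  have 2: "bracket a (bracket a u) = 0" for u
    using A_abelian assms lie_idealD(3)[OF A_ideal assms] by blast
  have "bracket (pmap a) u = 0" for u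
    using p_ge_2 by (cases "p - 1") (auto simp: ad_pmap_apply ad_pow_p_Suc funpow_Suc_right 2 simp del: funpow.simps)
  then have "bracket u (pmap a) = 0" for u using bracket_swap[of u "pmap a"] by simp
  then show ?thesis by (simp add: center_def centralizer_def)
qed

definition p_ideal_over_A :: "'v set \<Rightarrow> bool"
  where "p_ideal_over_A N \<longleftrightarrow> lie_ideal N \<and> (\<forall>v\<in>N. pmap v \<in> N) \<and> A \<subseteq> N"

lemma p_ideal_over_A_self: "p_ideal_over_A A"
  using A_ideal pmap_A_central center_subset_A by (auto simp: p_ideal_over_A_def)

text \<open>
  One step in the chain from \<open>A\<close> to \<open>L\<close>: \<open>N + F x\<close> is again a \<open>p\<close>-ideal, and \<open>x\<close> spans a
  central line with zero \<open>p\<close>-map in \<open>L/N\<close>.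
\<close>

definition central_step :: "'v set \<Rightarrow> 'v \<Rightarrow> bool"
  where "central_step N x \<longleftrightarrow> p_ideal_over_A N \<and> x \<notin> N \<and> (\<forall>u. bracket u x \<in> N) \<and> pmap x \<in> N"

lemma central_stepD:
  assumes "central_step N x"
  shows "lie_ideal N" "subspace N" "A \<subseteq> N" "v \<in> N \<Longrightarrow> pmap v \<in> N" "x \<notin> N" "bracket u x \<in> N"
    "bracket x u \<in> N" "pmap x \<in> N" "p_ideal_over_A N"
  using assms lie_idealD(1)[of N] bracket_swap[of x u] subspace_neg[of N "bracket u x"]
  by (auto simp: central_step_def p_ideal_over_A_def)

lemma central_step_adjoin:
  assumes st: "central_step N x"
  shows "p_ideal_over_A (adjoin N x)" "dim N < dim (adjoin N x)"
proof -
  note stD = central_stepD[OF st]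
  note adj = adjoin_lie_ideal[OF stD(1,6)]
  have "pmap v \<in> adjoin N x" if "v \<in> adjoin N x" for v
  proof -
    from that obtain t where t: "v - t \<cdot> x \<in> N" by (auto simp: adjoin_def)
    note sub = lie_idealD(1)[OF adj(1)]
    have tx: "t \<cdot> x \<in> adjoin N x" "v - t \<cdot> x \<in> adjoin N x"
      using adj t by (auto intro: subspace_scale[OF sub])
    have "pmap v = pmap (v - t \<cdot> x) + t ^ p \<cdot> pmap x + (\<Sum>i = 1..p - 1. jacobson_s p i (v - t \<cdot> x) (t \<cdot> x))"
      using pmap_add[of "v - t \<cdot> x" "t \<cdot> x"] by (simp add: pmap_scale)
    also have "\<dots> \<in> adjoin N x"
      using adj(2,3) stD(4)[OF t] stD(8) tx
      by (intro subspace_add subspace_sum sub jacobson_s_in_ideal adj(1) subspace_scale) auto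
    finally show ?thesis .
  qed
  with adj stD show "p_ideal_over_A (adjoin N x)" by (auto simp: p_ideal_over_A_def)
  show "dim N < dim (adjoin N x)"
    using adj stD lie_idealD(1)[OF adj(1)] by (intro dim_psubset_subspace) auto
qed

text \<open>
  Iterated \<open>p\<close>-th powers of an element become central, hence fall into \<open>A\<close>.  Starting with an element
  that is central modulo \<open>N\<close>, the last iterate outside \<open>N\<close> is suitable.
\<close>

lemma exists_central_step:
  assumes N: "p_ideal_over_A N" "N \<noteq> UNIV"
  obtains x where "central_step N x"
proof -
  have iN: "lie_ideal N" and AN: "A \<subseteq> N" using N by (auto simp: p_ideal_over_A_def)
  note sN = lie_idealD(1)[OF iN]
  have "lie_ideal UNIV" by (auto simp: lie_ideal_def subspace_UNIV)
  then obtain x0 where x0: "x0 \<notin> N" "\<And>u. bracket u x0 \<in> N"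
    using ideal_step[of UNIV N] N(2) subspace_0[OF sN] by blast
  have adp: "ad ((pmap ^^ n) x0) = ad x0 ^^ (p ^ n)" for n
  proof (induction n)
    case (Suc n)
    then show ?case by (simp add: ad_pmap funpow_mult mult.commute)
  qed simp
  have brN: "bracket u ((pmap ^^ n) x0) \<in> N" for n u
  proof (induction n arbitrary: u)
    case (Suc n)
    have "bracket ((pmap ^^ n) x0) u \<in> N" using Suc[of u] bracket_swap[of _ u] sN subspace_neg by metis
    then have "bracket (pmap ((pmap ^^ n) x0)) u \<in> N"
      unfolding ad_pmap_apply ad_pow_p_Suc by (rule lie_idealD(4)[OF iN])
    then show ?case using bracket_swap[of u] sN subspace_neg by fastforce
  qed (use x0 in auto)
  obtain c where c: "\<forall>n\<ge>c. lower_central n = {0}" using lower_central_eventually_zero by blast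
  have "c \<le> p ^ c"
  proof -
    have "c < 2 ^ c" by simp
    also have "2 ^ c \<le> p ^ c" using p_ge_2 by (intro power_mono) auto
    finally show ?thesis by simp
  qed
  then have "bracket ((pmap ^^ c) x0) u = 0" for u
    using ad_pow_in_lower_central[where n="p ^ c" and x=x0 and v=u] c by (auto simp: adp)
  then have "bracket u ((pmap ^^ c) x0) = 0" for u using bracket_swap[of u "(pmap ^^ c) x0"] by simp
  then have "(pmap ^^ c) x0 \<in> N" using A_centralizing AN by blast
  then have L: "(pmap ^^ (LEAST n. (pmap ^^ n) x0 \<in> N)) x0 \<in> N" by (rule LeastI)
  obtain m where m: "(LEAST n. (pmap ^^ n) x0 \<in> N) = Suc m"
    using L x0(1) by (cases "LEAST n. (pmap ^^ n) x0 \<in> N") auto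
  have "(pmap ^^ m) x0 \<notin> N" using not_less_Least[of m "\<lambda>n. (pmap ^^ n) x0 \<in> N"] m by simp
  moreover have "pmap ((pmap ^^ m) x0) \<in> N" using L m by simp
  ultimately have "central_step N ((pmap ^^ m) x0)" using N brN by (simp add: central_step_def)
  then show ?thesis by (rule that)
qed

section \<open>Extension and vanishing of cohomology\<close>

text \<open>
  The vanishing of the restricted cohomology group \<open>H\<^sup>1(N/A, A)\<close>.
\<close>

definition inner_on :: "'v set \<Rightarrow> bool"
  where "inner_on N \<longleftrightarrow> (\<forall>D. derivation_on N D \<longrightarrow> D ` N \<subseteq> A \<longrightarrow> (\<forall>a\<in>A. D a = 0) \<longrightarrow>
    (\<forall>y\<in>N. defect D y = 0) \<longrightarrow> (\<exists>a\<in>A. \<forall>u\<in>N. D u = bracket a u))"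

lemma inner_onD:
  assumes "inner_on N" "derivation_on N D" "D ` N \<subseteq> A" "\<forall>a\<in>A. D a = 0" "\<forall>y\<in>N. defect D y = 0"
  obtains a where "a \<in> A" "\<And>u. u \<in> N \<Longrightarrow> D u = bracket a u"
proof -
  have "\<exists>a\<in>A. \<forall>u\<in>N. D u = bracket a u"
    by (rule assms(1)[unfolded inner_on_def, THEN spec, THEN mp, THEN mp, THEN mp, THEN mp, OF assms(2-5)])
  then show ?thesis using that by metis
qed

text \<open>
  An extension of \<open>D\<close> must send \<open>x\<close> to \<open>m + w\<close> with \<open>w\<close> an \<open>N\<close>-invariant.  With \<open>x \<mapsto> m\<close> the
  defect at \<open>x\<close> is an invariant \<open>e\<close> that is also killed by \<open>ad x\<close>, so that the freeness
  assumption makes it of the form \<open>(ad x)\<^sup>p\<^sup>-\<^sup>1 w\<close>, and \<open>x \<mapsto> m + w\<close> has no defect.  The subspace \<open>K\<close>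
  bounds the defects on \<open>N\<close>; it is zero in one application and the center in the other.
\<close>

lemma extend_derivation:
  assumes st: "central_step N x"
    and D: "derivation_on N D" "D ` N \<subseteq> A" and m: "m \<in> A"
    and comm: "\<And>q. q \<in> N \<Longrightarrow> D (bracket x q) = bracket x (D q) + bracket m q"
    and K: "subspace K" "\<And>y. y \<in> N \<Longrightarrow> defect D y \<in> K"
    and free: "\<And>v. v \<in> centralizer N \<Longrightarrow> bracket x v = 0 \<Longrightarrow>
      \<exists>w\<in>centralizer N. v = (ad x ^^ (p - 1)) w"
  obtains D' where "derivation_on (adjoin N x) D'" "D' ` adjoin N x \<subseteq> A"
    "\<And>u. u \<in> N \<Longrightarrow> D' u = D u" "\<And>y. y \<in> adjoin N x \<Longrightarrow> defect D' y \<in> K"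
proof -
  note stD = central_stepD[OF st]
  note adj = adjoin_lie_ideal[OF stD(1,6)]
  note DD = derivation_onD[OF D(1)]
  define e where "e = D (pmap x) - (ad x ^^ (p - 1)) m"
  have "bracket q e = 0" if q: "q \<in> N" for q
  proof -
    interpret F: leibniz_bracket scale bracket "ad x" by (rule leibniz_bracket_ad)
    have "D ((ad x ^^ p) q) = (ad x ^^ p) (D q) + bracket ((ad x ^^ (p - 1)) m) q"
      by (rule F.commutator_W_pow_char[where S=N, OF char_eq char_pos])
        (use comm q stD in auto)
    moreover have "D ((ad x ^^ p) q) = bracket (D (pmap x)) q + (ad x ^^ p) (D q)"
      using DD(3)[OF stD(8) q] by (simp add: ad_pmap_apply)
    ultimately have "bracket e q = 0" by (simp add: e_def bracket_diff_left)
    then show ?thesis using bracket_swap[of q e] by simp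
  qed
  then have eC: "e \<in> centralizer N" by (simp add: centralizer_def)
  have "bracket x e = 0"
  proof -
    have "bracket (pmap x) x = 0" by (simp add: ad_pmap_apply ad_pow_p_Suc bracket_self)
    then have "bracket x (pmap x) = 0" using bracket_swap[of x "pmap x"] by simp
    then have "bracket x (D (pmap x)) = - bracket m (pmap x)"
      using comm[OF stD(8)] DD(4)[OF subspace_0[OF stD(2)]] by (simp add: eq_neg_iff_add_eq_0)
    also have "\<dots> = (ad x ^^ p) m" using bracket_swap[of m "pmap x"] by (simp add: ad_pmap_apply)
    finally show ?thesis by (simp add: e_def bracket_diff_right ad_pow_p_Suc')
  qed
  then obtain w where w: "w \<in> centralizer N" "e = (ad x ^^ (p - 1)) w" using free eC by blast
  define m' where "m' = m + w"
  have m'A: "m' \<in> A" using m w centralizer_subset_A[OF stD(3)] subspace_A by (auto simp: m'_def subspace_add)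
  have comm': "D (bracket x q) = bracket x (D q) + bracket m' q" if "q \<in> N" for q
    using comm[OF that] centralizer_swap[OF w(1) that] by (simp add: m'_def bracket_add_left)
  have e': "D (pmap x) = (ad x ^^ (p - 1)) m'" using w(2) by (simp add: m'_def ad_pow_add e_def algebra_simps)
  obtain l where l: "\<And>u v. l (u + v) = l u + l v" "\<And>c u. l (c \<cdot> u) = c * l u"
    "\<And>v. v \<in> N \<Longrightarrow> l v = 0" "l x = 1" "\<And>v. v \<in> adjoin N x \<Longrightarrow> v - l v \<cdot> x \<in> N"
    using adjoin_functional[OF stD(2,5)] by metis
  define D' where "D' v = D (v - l v \<cdot> x) + l v \<cdot> m'" for v
  have D'N: "D' u = D u" if "u \<in> N" for u using that l(3) by (simp add: D'_def)
  have D'x: "D' x = m'" using l(4) DD(4)[OF subspace_0[OF stD(2)]] by (simp add: D'_def)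
  have D'A: "D' ` adjoin N x \<subseteq> A"
    using l(5) D(2) m'A subspace_A by (auto simp: D'_def intro!: subspace_add subspace_scale)
  have der: "derivation_on (adjoin N x) D'"
    unfolding derivation_on_def
  proof (intro conjI ballI allI)
    fix u v assume uv: "u \<in> adjoin N x" "v \<in> adjoin N x"
    have "(u + v) - l (u + v) \<cdot> x = (u - l u \<cdot> x) + (v - l v \<cdot> x)"
      by (simp add: l scale_left_distrib)
    note eq = this
    show "D' (u + v) = D' u + D' v"
      unfolding D'_def eq DD(1)[OF l(5)[OF uv(1)] l(5)[OF uv(2)]]
      by (simp add: l scale_left_distrib)
    define n where "n = u - l u \<cdot> x"
    define n' where "n' = v - l v \<cdot> x"
    have nN: "n \<in> N" "n' \<in> N" using l(5) uv by (auto simp: n_def n'_def)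
    have u: "u = n + l u \<cdot> x" and v: "v = n' + l v \<cdot> x" by (simp_all add: n_def n'_def)
    have br: "bracket u v = (bracket n n' + l u \<cdot> bracket x n') + - (l v \<cdot> bracket x n)"
      by (subst u, subst v) (simp add: bracket_add_left bracket_add_right bracket_scale_left
          bracket_scale_right bracket_self bracket_swap[of n x] scale_right_distrib)
    have inN: "bracket n n' \<in> N" "bracket x n' \<in> N" "bracket x n \<in> N"
      using nN lie_idealD(2)[OF stD(1)] by auto
    have "D' (bracket u v) = D (bracket u v)" using adj(4)[OF uv(2)] D'N by blast
    also have "\<dots> = (D (bracket n n') + l u \<cdot> D (bracket x n')) + - (l v \<cdot> D (bracket x n))"
      unfolding br using inN stD(2)
        DD(1)[of "bracket n n'" "l u \<cdot> bracket x n'"] DD(2)[of "bracket x n'"] DD(2)[of "bracket x n"]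
        DD(1)[of "bracket n n' + l u \<cdot> bracket x n'" "- (l v \<cdot> bracket x n)"]
        DD(5)[of "l v \<cdot> bracket x n"]
      by (simp add: subspace_add subspace_scale subspace_neg)
    also have "\<dots> = bracket (D n + l u \<cdot> m') (n' + l v \<cdot> x) + bracket (n + l u \<cdot> x) (D n' + l v \<cdot> m')"
      using nN by (simp add: DD(3) comm' bracket_add_left bracket_add_right bracket_scale_left
          bracket_scale_right scale_right_distrib bracket_swap[of "D n" x] bracket_swap[of n m']
          bracket_swap[of m' x] mult.commute scale_right_diff_distrib)
    also have "\<dots> = bracket (D' u) v + bracket u (D' v)"
      by (simp only: u[symmetric] v[symmetric], simp only: D'_def n_def n'_def)
    finally show "D' (bracket u v) = bracket (D' u) v + bracket u (D' v)" .
  next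
    fix c u assume u: "u \<in> adjoin N x"
    have "c \<cdot> u - l (c \<cdot> u) \<cdot> x = c \<cdot> (u - l u \<cdot> x)" by (simp add: l scale_right_diff_distrib)
    then show "D' (c \<cdot> u) = c \<cdot> D' u"
      using DD(2)[OF l(5)[OF u], of c] unfolding D'_def by (simp add: l scale_right_distrib)
  qed
  have "defect D' y \<in> K" if y: "y \<in> adjoin N x" for y
  proof -
    note sub = lie_idealD(1)[OF adj(1)]
    note pi = central_step_adjoin(1)[OF st]
    define n where "n = y - l y \<cdot> x"
    have n: "n \<in> N" "y = n + l y \<cdot> x" using l(5)[OF y] by (auto simp: n_def)
    have in': "n \<in> adjoin N x" "l y \<cdot> x \<in> adjoin N x"
      using n adj subspace_scale[OF sub] by auto
    have "defect D' y = defect D' n + defect D' (l y \<cdot> x)"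
      by (subst n(2)) (use defect_add[OF adj(1) der in'] pi in' in \<open>auto simp: p_ideal_over_A_def\<close>)
    also have "defect D' (l y \<cdot> x) = (l y) ^ p \<cdot> defect D' x"
      by (rule defect_scale[OF adj(1) der adj(3)]) (use stD(8) adj in auto)
    also have "defect D' x = 0" using e' D'N[OF stD(8)] by (simp add: defect_def D'x)
    also have "defect D' n = defect D n" using n stD(4)[OF n(1)] by (simp add: defect_def D'N)
    finally show ?thesis using K(2)[OF n(1)] by simp
  qed
  with der D'A D'N that show ?thesis by blast
qed

text \<open>
  On the space of \<open>N\<close>-invariants \<open>(ad x)\<^sup>p = 0\<close>.  An invariant \<open>v\<close> with
  \<open>(ad x)\<^sup>p\<^sup>-\<^sup>1 v = 0\<close> defines the restricted derivation \<open>N \<mapsto> 0\<close>, \<open>x \<mapsto> v\<close>, which is inner, so \<open>v\<close> is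
  in the image of \<open>ad x\<close>.  Applied \<open>p - 1\<close> times, this writes every \<open>v\<close> in the kernel of \<open>ad x\<close> as
  \<open>(ad x)\<^sup>p\<^sup>-\<^sup>1 w\<close>: the invariants form a free module over \<open>F[ad x]\<close>.
\<close>

lemma free_if_inner_on:
  assumes st: "central_step N x" and P: "inner_on (adjoin N x)"
    and v: "v \<in> centralizer N" "bracket x v = 0"
  shows "\<exists>w\<in>centralizer N. v = (ad x ^^ (p - 1)) w"
proof -
  note stD = central_stepD[OF st]
  note adj = adjoin_lie_ideal[OF stD(1,6)]
  have ex: "\<exists>a\<in>centralizer N. v = bracket x a"
    if v: "v \<in> centralizer N" "(ad x ^^ (p - 1)) v = 0" for v
  proof -
    obtain l where l: "\<And>u v. l (u + v) = l u + l v" "\<And>c u. l (c \<cdot> u) = c * l u"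
      "\<And>v. v \<in> N \<Longrightarrow> l v = 0" "l x = 1" "\<And>v. v \<in> adjoin N x \<Longrightarrow> v - l v \<cdot> x \<in> N"
      using adjoin_functional[OF stD(2,5)] by metis
    define D where "D u = l u \<cdot> v" for u
    have vA: "v \<in> A" using v centralizer_subset_A stD by blast
    have split: "bracket u v = l u \<cdot> bracket x v" if "u \<in> adjoin N x" for u
    proof -
      have "bracket (u - l u \<cdot> x) v = 0" using v(1) l(5)[OF that] by (auto simp: centralizer_def)
      then show ?thesis by (simp add: bracket_diff_left bracket_scale_left)
    qed
    have der: "derivation_on (adjoin N x) D"
      unfolding derivation_on_def
    proof (intro conjI ballI allI)
      fix s t assume st: "s \<in> adjoin N x" "t \<in> adjoin N x"
      have "bracket v t = - (l t \<cdot> bracket x v)" using split[OF st(2)] bracket_swap[of v t] by simp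
      then show "D (bracket s t) = bracket (D s) t + bracket s (D t)"
        using l(3)[OF adj(4)[OF st(2)]] split[OF st(1)]
        by (simp add: D_def bracket_scale_left bracket_scale_right mult.commute)
    qed (auto simp: D_def l scale_left_distrib)
    have "defect D y = 0" if y: "y \<in> adjoin N x" for y
    proof -
      note sub = lie_idealD(1)[OF adj(1)]
      note pi = central_step_adjoin(1)[OF st]
      define n where "n = y - l y \<cdot> x"
      have n: "n \<in> N" "y = n + l y \<cdot> x" using l(5)[OF y] by (auto simp: n_def)
      have in': "n \<in> adjoin N x" "l y \<cdot> x \<in> adjoin N x"
        using n adj subspace_scale[OF sub] by auto
      have "defect D y = defect D n + defect D (l y \<cdot> x)"
        by (subst n(2)) (use defect_add[OF adj(1) der in'] pi in' in \<open>auto simp: p_ideal_over_A_def\<close>)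
      also have "defect D (l y \<cdot> x) = (l y) ^ p \<cdot> defect D x"
        by (rule defect_scale[OF adj(1) der adj(3)]) (use stD(8) adj in auto)
      also have "defect D x = 0" using l(3)[OF stD(8)] l(4) v(2) by (simp add: defect_def D_def)
      also have "defect D n = 0" using n stD(4)[OF n(1)] by (simp add: defect_def D_def l(3))
      finally show ?thesis by simp
    qed
    moreover have "D ` adjoin N x \<subseteq> A" using vA subspace_A by (auto simp: D_def subspace_scale)
    moreover have "\<forall>a\<in>A. D a = 0" using stD(3) l(3) by (auto simp: D_def)
    ultimately obtain a where a: "a \<in> A" "\<And>u. u \<in> adjoin N x \<Longrightarrow> D u = bracket a u"
      using inner_onD[OF P der] by metis
    have "bracket u (- a) = 0" if "u \<in> N" for u
      using a(2)[of u] adj(2) that l(3)[OF that] bracket_swap[of u a] by (auto simp: D_def bracket_minus_right)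
    then have "- a \<in> centralizer N" by (simp add: centralizer_def)
    moreover have "v = bracket x (- a)"
      using a(2)[OF adj(3)] l(4) bracket_swap[of x a] by (simp add: D_def bracket_minus_right)
    ultimately show ?thesis by blast
  qed
  have "\<exists>w\<in>centralizer N. v = (ad x ^^ j) w" if "j \<le> p - 1" for j
    using that
  proof (induction j)
    case (Suc j)
    then obtain w where w: "w \<in> centralizer N" "v = (ad x ^^ j) w" by auto
    have "p - 1 = (p - 2 - j) + Suc j" using Suc by simp
    then have "(ad x ^^ (p - 1)) w = (ad x ^^ (p - 2 - j)) (bracket x v)"
      by (simp only: funpow_add funpow.simps comp_apply w(2))
    then have "(ad x ^^ (p - 1)) w = 0" using v(2) by simp
    then obtain a where "a \<in> centralizer N" "w = bracket x a" using ex w(1) by blast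
    then show ?case using w(2) by (auto simp: funpow_Suc_right simp del: funpow.simps)
  qed (use v in auto)
  then show ?thesis by simp
qed

lemma commutator_derivation_on:
  assumes N: "p_ideal_over_A N" and D: "derivation_on N D" "D ` N \<subseteq> A"
    and A: "\<And>a. a \<in> A \<Longrightarrow> D (bracket x a) = bracket x (D a)"
    and c: "\<And>y. y \<in> N \<Longrightarrow> bracket x (defect D y) = 0"
  defines "E \<equiv> \<lambda>u. bracket x (D u) - D (bracket x u)"
  shows "derivation_on N E" "E ` N \<subseteq> A" "\<forall>a\<in>A. E a = 0" "\<forall>y\<in>N. defect E y = 0"
proof -
  have iN: "lie_ideal N" using N by (simp add: p_ideal_over_A_def)
  note DD = derivation_onD[OF D(1)] and NN = lie_idealD[OF iN]
  show "derivation_on N E"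
    unfolding derivation_on_def
  proof (intro conjI ballI allI)
    fix u v assume uv: "u \<in> N" "v \<in> N"
    have xu: "bracket x u \<in> N" "bracket x v \<in> N" using uv NN by auto
    show "E (bracket u v) = bracket (E u) v + bracket u (E v)"
      using uv xu NN
      by (simp add: E_def DD(3) bracket_leibniz[of x u v] bracket_leibniz[of x "D u" v]
          bracket_leibniz[of x u "D v"] bracket_add_right DD(1)
          bracket_diff_left bracket_diff_right)
  qed (use NN in \<open>auto simp: E_def DD bracket_add_right bracket_scale_right scale_right_diff_distrib\<close>)
  show "E ` N \<subseteq> A"
    using D(2) NN lie_idealD[OF A_ideal] by (auto simp: E_def image_subset_iff intro!: subspace_diff)
  show "\<forall>a\<in>A. E a = 0" by (simp add: E_def A)
  show "\<forall>y\<in>N. defect E y = 0"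
    using N unfolding E_def p_ideal_over_A_def by (auto intro!: defect_commutator[OF _ D(1)] c)
qed

text \<open>
  If the commutator of \<open>D\<close> with \<open>ad x\<close> is inner, then \<open>D\<close> extends to \<open>N + F x\<close>, where it is inner by
  assumption.  The passage from \<open>D\<close> to this commutator pushes the values of \<open>D\<close> one step further
  down the lower central series, so after finitely many passages the derivation is zero.
\<close>

lemma inner_on_descend:
  assumes st: "central_step N x" and P: "inner_on (adjoin N x)"
  shows "inner_on N"
proof -
  note stD = central_stepD[OF st]
  note adj = adjoin_lie_ideal[OF stD(1,6)]
  obtain c where c: "\<forall>n\<ge>c. lower_central n = {0}" using lower_central_eventually_zero by blast
  \<comment> \<open>The derivation lowers the filtration by at most \<open>c\<close> at the outset (\<open>k = 2 c\<close>) and raises it by \<open>c\<close> at the end (\<open>k = 0\<close>), when it must be zero.\<close>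
  have main: "\<exists>a\<in>A. \<forall>u\<in>N. D u = bracket a u"
    if D: "derivation_on N D" "D ` N \<subseteq> A" "\<forall>a\<in>A. D a = 0" "\<forall>y\<in>N. defect D y = 0"
      and fil: "\<And>i q. q \<in> N \<Longrightarrow> q \<in> lower_central i \<Longrightarrow> D q \<in> lower_central (i + (2 * c - k) - c)"
    for k D using that
  proof (induction k arbitrary: D)
    case 0
    have "D u = bracket 0 u" if "u \<in> N" for u
      using "0.prems"(5)[OF that, of 0] c by simp
    then show ?case using zero_in_A by blast
  next
    case (Suc k)
    define E where "E u = bracket x (D u) - D (bracket x u)" for u
    have DA: "D (bracket x a) = bracket x (D a)" if "a \<in> A" for a
      using that Suc.prems(3) lie_idealD(2)[OF A_ideal that] by simp
    note com = commutator_derivation_on[OF stD(9) Suc.prems(1,2) DA]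
    have "\<exists>a\<in>A. \<forall>u\<in>N. E u = bracket a u"
    proof (rule Suc.IH)
      show "derivation_on N E" "E ` N \<subseteq> A" "\<forall>a\<in>A. E a = 0" "\<forall>y\<in>N. defect E y = 0"
        using com Suc.prems(4) unfolding E_def by auto
      fix i q assume q: "q \<in> N" "q \<in> lower_central i"
      let ?j = "i + (2 * c - k) - c"
      have 1: "bracket x (D q) \<in> lower_central ?j"
        by (rule subsetD[OF lower_central_mono bracket_in_lower_central[OF Suc.prems(5)[OF q]]]) simp
      have 2: "D (bracket x q) \<in> lower_central ?j"
        by (rule subsetD[OF lower_central_mono
              Suc.prems(5)[OF lie_idealD(2)[OF stD(1) q(1)] bracket_in_lower_central[OF q(2)]]]) simp
      show "E q \<in> lower_central ?j"
        unfolding E_def by (rule subspace_diff[OF subspace_lower_central 1 2])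
    qed
    then obtain m where m: "m \<in> A" "\<And>u. u \<in> N \<Longrightarrow> E u = bracket m u" by blast
    have comm: "D (bracket x q) = bracket x (D q) + bracket (- m) q" if "q \<in> N" for q
      using m(2)[OF that] by (simp add: E_def bracket_minus_left algebra_simps)
    have "- m \<in> A" using m subspace_A subspace_neg by blast
    then obtain D' where D': "derivation_on (adjoin N x) D'" "D' ` adjoin N x \<subseteq> A"
      "\<And>u. u \<in> N \<Longrightarrow> D' u = D u" "\<And>y. y \<in> adjoin N x \<Longrightarrow> defect D' y \<in> {0}"
      using extend_derivation[OF st Suc.prems(1,2) _ comm subspace_single_0 _ free_if_inner_on[OF st P]]
        Suc.prems(4) by (metis insertI1)
    moreover have "\<forall>a\<in>A. D' a = 0" "\<forall>y\<in>adjoin N x. defect D' y = 0"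
      using D'(3,4) stD(3) Suc.prems(3) by auto
    ultimately obtain a where "a \<in> A" "\<And>u. u \<in> adjoin N x \<Longrightarrow> D' u = bracket a u"
      using inner_onD[OF P D'(1,2)] by metis
    then show ?case using D'(3) adj(2) by (metis subsetD)
  qed
  show ?thesis
    unfolding inner_on_def
  proof (intro allI impI)
    fix D assume D: "derivation_on N D" "D ` N \<subseteq> A" "\<forall>a\<in>A. D a = 0" "\<forall>y\<in>N. defect D y = 0"
    show "\<exists>a\<in>A. \<forall>u\<in>N. D u = bracket a u"
    proof (rule main[OF D, of "2 * c"])
      fix i q assume q: "q \<in> N" "q \<in> lower_central i"
      show "D q \<in> lower_central (i + (2 * c - 2 * c) - c)"
      proof (cases "i \<le> c")
        case False
        then have "q = 0" using q c by auto
        then show ?thesis using derivation_onD(4)[OF D(1)] q subspace_0[OF subspace_lower_central] by simp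
      qed auto
    qed
  qed
qed

lemma inner_on_all:
  assumes "inner_on UNIV" "p_ideal_over_A N"
  shows "inner_on N"
  using assms(2)
proof (induction "dimension - dim N" arbitrary: N rule: less_induct)
  case less
  show ?case
  proof (cases "N = UNIV")
    case False
    then obtain x where st: "central_step N x" using exists_central_step less.prems by blast
    note a = central_step_adjoin[OF st]
    have "dimension - dim (adjoin N x) < dimension - dim N"
      using a(2) dim_subset_UNIV[of "adjoin N x"] by linarith
    then show ?thesis using less.hyps a(1) inner_on_descend[OF st] by blast
  qed (use assms in simp)
qed

text \<open>
  The identity of \<open>A\<close> commutes with the action of \<open>L\<close>, so at each step the commutator of the partial
  extension with \<open>ad x\<close> vanishes on \<open>A\<close> and is therefore inner.  Central defects have to be
  admitted because the identity of \<open>A\<close> itself has the defect \<open>a \<mapsto> a\<^sup>[\<^sup>p\<^sup>]\<close>.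
\<close>

lemma exists_retraction_derivation:
  assumes P: "inner_on UNIV"
  obtains D where "derivation_on UNIV D" "\<And>u. D u \<in> A" "\<And>a. a \<in> A \<Longrightarrow> D a = a"
    "\<And>y. defect D y \<in> center"
proof -
  define Q where "Q N D \<longleftrightarrow> derivation_on N D \<and> D ` N \<subseteq> A \<and> (\<forall>a\<in>A. D a = a) \<and> (\<forall>y\<in>N. defect D y \<in> center)" for N D
  have cs: "subspace center"
    using lie_ideal_centralizer[of UNIV] lie_idealD(1) by (auto simp: center_def lie_ideal_def subspace_UNIV)
  have "\<exists>D. Q UNIV D" if "p_ideal_over_A N" "Q N D" for N D
    using that
  proof (induction "dimension - dim N" arbitrary: N D rule: less_induct)
    case less
    show ?case
    proof (cases "N = UNIV")
      case False
      then obtain x where st: "central_step N x" using exists_central_step less.prems by blast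
      note a = central_step_adjoin[OF st]
      have D: "derivation_on N D" "D ` N \<subseteq> A" "\<forall>a\<in>A. D a = a" "\<forall>y\<in>N. defect D y \<in> center"
        using less.prems(2) by (auto simp: Q_def)
      have DA: "D (bracket x a) = bracket x (D a)" if "a \<in> A" for a
        using that D(3) lie_idealD(2)[OF A_ideal that] by simp
      have cc: "bracket x (defect D y) = 0" if "y \<in> N" for y
        using centerD(1) D(4) that by blast
      note com = commutator_derivation_on[OF less.prems(1) D(1,2) DA cc]
      obtain m where m: "m \<in> A" "\<And>u. u \<in> N \<Longrightarrow> bracket x (D u) - D (bracket x u) = bracket m u"
        using inner_onD[OF inner_on_all[OF P less.prems(1)] com] by blast
      have comm: "D (bracket x q) = bracket x (D q) + bracket (- m) q" if "q \<in> N" for q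
        using m(2)[OF that] by (simp add: bracket_minus_left algebra_simps)
      have mA: "- m \<in> A" using m subspace_A subspace_neg by blast
      obtain D' where "derivation_on (adjoin N x) D'" "D' ` adjoin N x \<subseteq> A"
        "\<And>u. u \<in> N \<Longrightarrow> D' u = D u" "\<And>y. y \<in> adjoin N x \<Longrightarrow> defect D' y \<in> center"
        using extend_derivation[OF st D(1,2) mA comm cs _ free_if_inner_on[OF st inner_on_all[OF P a(1)]]] D(4)
        by metis
      then have "Q (adjoin N x) D'" using D(3) central_stepD(3)[OF st] unfolding Q_def by auto
      moreover have "dimension - dim (adjoin N x) < dimension - dim N"
        using a(2) dim_subset_UNIV[of "adjoin N x"] by linarith
      ultimately show ?thesis using less.hyps a(1) by blast
    qed (use less.prems in auto)
  qed
  moreover have "Q A (\<lambda>x. x)"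
  proof -
    have "(ad y ^^ (p - 1)) y = 0" for y
      using p_ge_2 by (cases "p - 1") (auto simp: funpow_Suc_right bracket_self simp del: funpow.simps)
    then show ?thesis
      using pmap_A_central A_abelian lie_idealD(2)[OF A_ideal]
      by (auto simp: Q_def derivation_on_def defect_def)
  qed
  ultimately obtain D where "Q UNIV D" using p_ideal_over_A_self by blast
  then show ?thesis using that by (auto simp: Q_def)
qed

end

section \<open>Hyperplanes and the Heisenberg algebra\<close>

context self_centralizing_ideal
begin

text \<open>
  A derivation as in \<open>exists_retraction_derivation\<close> maps brackets and \<open>p\<close>-th powers into
  \<open>[L, A]\<close>; the central defects lie there because the freeness of \<open>A\<close> makes every central element
  an iterated bracket.  If \<open>A\<close> were contained in their span, then \<open>A = [L, A]\<close>, against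
  nilpotency.
\<close>

lemma A_not_subset_Frattini:
  assumes P: "inner_on UNIV" and nA: "A \<noteq> UNIV"
  shows "\<not> A \<subseteq> span ({bracket u v | u v. True} \<union> range pmap)"
proof
  assume sub: "A \<subseteq> span ({bracket u v | u v. True} \<union> range pmap)"
  obtain D where D: "derivation_on UNIV D" "\<And>u. D u \<in> A" "\<And>a. a \<in> A \<Longrightarrow> D a = a"
    "\<And>y. defect D y \<in> center"
    using exists_retraction_derivation[OF P] by metis
  note DD = derivation_onD[OF D(1)]
  define C where "C = span {bracket u a | u a. a \<in> A}"
  have sC: "subspace C" by (simp add: C_def)
  have brC: "bracket u a \<in> C" if "a \<in> A" for u a
    using that by (auto simp: C_def intro: span_base)
  have brC': "bracket a u \<in> C" if "a \<in> A" for u a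
    using brC[OF that, of u] bracket_swap[of a u] subspace_neg[OF sC] by simp
  have powC: "(ad y ^^ (p - 1)) a \<in> C" if "a \<in> A" for y a
  proof -
    obtain k where k: "p - 1 = Suc k" using p_ge_2 by (cases "p - 1") auto
    show ?thesis unfolding k using brC[OF lie_idealD(4)[OF A_ideal that]] by simp
  qed
  have "center \<subseteq> C"
  proof
    fix z assume z: "z \<in> center"
    obtain x where st: "central_step A x" using exists_central_step[OF p_ideal_over_A_self nA] by blast
    have "z \<in> centralizer A" using z centerD(1) by (auto simp: centralizer_def)
    then obtain w where "w \<in> centralizer A" "z = (ad x ^^ (p - 1)) w"
      using free_if_inner_on[OF st inner_on_all[OF P central_step_adjoin(1)[OF st]]] centerD(1)[OF z] by metis
    then show "z \<in> C" using powC centralizer_A by blast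
  qed
  then have defC: "defect D y \<in> C" for y using D(4) by blast
  have "D v \<in> C" if "v \<in> span ({bracket u v | u v. True} \<union> range pmap)" for v
  proof -
    have "subspace {v. D v \<in> C}"
      using sC by (auto simp: subspace_def DD)
    moreover have "D (bracket u v) \<in> C" for u v
      using DD(3)[of u v] brC[OF D(2)] brC'[OF D(2)] by (simp add: subspace_add[OF sC])
    moreover have "D (pmap y) \<in> C" for y
      using subspace_add[OF sC defC[of y] powC[OF D(2), of y y]] by (simp add: defect_def)
    ultimately have "span ({bracket u v | u v. True} \<union> range pmap) \<subseteq> {v. D v \<in> C}"
      by (intro span_minimal) auto
    from subsetD[OF this that] show ?thesis by simp
  qed
  then have "D a \<in> C" if "a \<in> A" for a using subsetD[OF sub that] by simp
  then have AC: "A \<subseteq> C" using D(3) by auto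
  have "A \<subseteq> lower_central n" for n
  proof (induction n)
    case (Suc n)
    have "C \<subseteq> lower_central (Suc n)"
      unfolding C_def lower_central.simps using Suc by (intro span_mono) auto
    with AC show ?case by blast
  qed simp
  then have "A \<subseteq> {0}" using nilpotent unfolding nilpotent_def by metis
  then have "centralizer A = UNIV" by (auto simp: centralizer_def)
  then show False using centralizer_A nA by simp
qed

lemma inner_on_UNIV:
  assumes no: "\<And>D. restricted_derivation D \<Longrightarrow> D \<circ> D = (\<lambda>x. 0) \<Longrightarrow> inner_derivation D"
  shows "inner_on UNIV"
  unfolding inner_on_def
proof (intro allI impI)
  fix D assume D: "derivation_on UNIV D" "D ` UNIV \<subseteq> A" "\<forall>a\<in>A. D a = 0" "\<forall>y\<in>UNIV. defect D y = 0"
  have "restricted_derivation D"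
    using D(1,4) by (simp add: restricted_derivation_def linear_derivation_iff defect_def)
  moreover have "D \<circ> D = (\<lambda>x. 0)" using D(2,3) by (auto simp: fun_eq_iff)
  ultimately have "inner_derivation D" by (rule no)
  then obtain a where a: "D = ad a" unfolding inner_derivation_def by (rule exE)
  have "bracket b a = 0" if "b \<in> A" for b using D(3) that bracket_swap[of b a] by (simp add: a)
  then have "a \<in> A" by (rule A_centralizing)
  with a show "\<exists>a\<in>A. \<forall>u\<in>UNIV. D u = bracket a u" by (intro bexI[of _ a]) auto
qed

text \<open>
  The element \<open>x\<close> of \<open>A\<close> lies outside the hyperplane \<open>I\<close>, the kernel of \<open>l\<close>.  A nonzero central
  \<open>z\<close> in \<open>I\<close> must be of the form \<open>[e, x]\<close> with \<open>e\<close> in the centralizer of \<open>I\<close>.  If \<open>p > 2\<close>, the same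
  test applies to \<open>e\<close>, since \<open>(ad x)\<^sup>2 e = 0\<close>, and gives \<open>e = [a, x]\<close>; but then
  \<open>z = [[a, x], x] = 0\<close> because \<open>x\<close> and \<open>[a, x]\<close> lie in \<open>A\<close>.  If \<open>p = 2\<close>, freeness of
  \<open>A\<close> over \<open>ad e\<close> gives \<open>A \<inter> I = F z\<close>, hence \<open>A = F x + F z\<close>, and since \<open>A\<close> is its own
  centralizer, each element of \<open>L\<close> is determined modulo \<open>A\<close> by its bracket with \<open>x\<close>.
\<close>

lemma heisenberg_basis_exists:
  assumes no: "\<And>D. restricted_derivation D \<Longrightarrow> D \<circ> D = (\<lambda>x. 0) \<Longrightarrow> inner_derivation D"
    and nonab: "\<not> abelian"
  obtains e x z where "p = 2" "z \<in> center" "bracket e x = z" "z \<noteq> 0"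
    "\<And>y. \<exists>r s t. y = r \<cdot> e + s \<cdot> x + t \<cdot> z"
proof -
  note P = inner_on_UNIV[OF no]
  have nA: "A \<noteq> UNIV" using nonab A_abelian by (auto simp: abelian_def)
  define F where "F = span ({bracket u v | u v. True} \<union> range pmap)"
  have sF: "subspace F" by (simp add: F_def)
  obtain x where x: "x \<in> A" "x \<notin> F" using A_not_subset_Frattini[OF P nA] unfolding F_def by blast
  obtain l where l: "\<And>u v. l (u + v) = l u + l v" "\<And>c u. l (c \<cdot> u) = c * l u"
    "\<And>v. v \<in> F \<Longrightarrow> l v = 0" "l x = 1"
    using exists_functional[OF sF x(2)] by metis
  have lbr: "l (bracket u v) = 0" for u v
    by (rule l(3)[unfolded F_def, OF span_base]) blast
  have lpm: "l (pmap u) = 0" for u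
    by (rule l(3)[unfolded F_def, OF span_base]) blast
  have lx: "l (u - l u \<cdot> x) = 0" for u using l(1)[of "u - l u \<cdot> x" "l u \<cdot> x"] l(2,4) by simp
  define I where "I = {v. l v = 0}"
  \<comment> \<open>For such \<open>z\<close> the derivation that kills \<open>I\<close> and sends \<open>x\<close> to \<open>z\<close> is inner.\<close>
  have hyper: "\<exists>a\<in>centralizer I. z = bracket a x"
    if "z \<in> I" "z \<in> centralizer I" "(ad x ^^ (p - 1)) z = 0" for z
  proof -
    have "\<And>i. l i = 0 \<Longrightarrow> bracket i z = 0" using that by (simp add: I_def centralizer_def)
    note fd = functional_derivation[of l x z, OF l(1,2) lbr lpm l(4) _ this that(3)]
    have "inner_derivation (\<lambda>v. l v \<cdot> z)" using fd that(1) by (intro no) (simp_all add: I_def)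
    then obtain a where a: "\<And>v. l v \<cdot> z = bracket a v" unfolding inner_derivation_def by metis
    have "bracket i a = 0" if "i \<in> I" for i
      using a[of i] that bracket_swap[of i a] by (simp add: I_def)
    then show ?thesis using a[of x] l(4) by (auto simp: centralizer_def)
  qed
  have "\<not> span {bracket u v | u v. True} \<subseteq> {0}"
    using nonab by (auto simp: abelian_def dest: subsetD[OF _ span_base])
  then obtain z where z: "z \<in> span {bracket u v | u v. True}" "z \<noteq> 0" "\<And>u. bracket u z = 0"
    using ideal_step[OF lie_ideal_derived, of "{0}"] by auto
  have zI: "z \<in> I" using l(3)[unfolded F_def, OF subsetD[OF span_mono z(1)]] by (auto simp: I_def)
  have zc: "z \<in> center" "z \<in> centralizer I" using z(3) by (auto simp: center_def centralizer_def)
  obtain k where k: "p - 1 = Suc k" using p_ge_2 by (cases "p - 1") auto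
  have kill: "(ad x ^^ (p - 1)) v = 0" if "bracket x v = 0" for v
    unfolding k by (simp add: funpow_Suc_right that del: funpow.simps)
  obtain e where e: "e \<in> centralizer I" "z = bracket e x"
    using hyper[OF zI zc(2) kill[OF z(3)]] by blast
  have ex: "bracket x e = - z" using e(2) bracket_swap[of x e] by simp
  have ue: "bracket u e = - (l u \<cdot> z)" for u
  proof -
    have "bracket (u - l u \<cdot> x) e = 0" using e(1) lx by (auto simp: centralizer_def I_def)
    then show ?thesis by (simp add: bracket_diff_left bracket_scale_left ex eq_neg_iff_add_eq_0)
  qed
  have "l e = 0"
  proof -
    have "l e \<cdot> z = 0" using ue[of e] by (simp add: bracket_self)
    then show ?thesis using z(2) by simp
  qed
  then have eI: "e \<in> I" by (simp add: I_def)
  have p2: "p = 2"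
  proof (rule ccontr)
    assume "p \<noteq> 2"
    then have "p - 1 = Suc (Suc (p - 3))" using p_ge_2 by linarith
    moreover have "bracket x (bracket x e) = 0" using z(3)[of x] by (simp add: ex bracket_minus_right)
    ultimately have "(ad x ^^ (p - 1)) e = 0" by (simp add: funpow_Suc_right del: funpow.simps)
    then obtain a where a: "e = bracket a x" using hyper[OF eI e(1)] by blast
    have "bracket x (bracket a x) = 0"
      using A_abelian x(1) lie_idealD(2)[OF A_ideal x(1)] by blast
    then show False using ex z(2) a by simp
  qed
  have zA: "z \<in> A" using center_subset_A zc by blast
  have eA: "e \<notin> A" using A_abelian[OF x(1), of e] ex z(2) by auto
  have "central_step A e"
    unfolding central_step_def
  proof (intro conjI allI)
    show "bracket u e \<in> A" for u
      using zA subspace_A by (simp add: ue subspace_neg subspace_scale)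
    have "bracket e (bracket e u) = 0" for u
    proof -
      have "bracket e u = l u \<cdot> z" using ue[of u] bracket_swap[of e u] by simp
      then show ?thesis using z(3) by (simp add: bracket_scale_right)
    qed
    then have "bracket (pmap e) u = 0" for u by (simp add: ad_pmap_apply p2 numeral_2_eq_2)
    then have "bracket u (pmap e) = 0" for u using bracket_swap[of u "pmap e"] by simp
    then show "pmap e \<in> A" using A_centralizing by blast
  qed (use p_ideal_over_A_self eA in auto)
  note st = this
  have AI: "\<exists>t. v = t \<cdot> z" if v: "v \<in> A" "l v = 0" for v
  proof -
    have "bracket e v = 0" using ue[of v] v bracket_swap[of e v] by simp
    then obtain w where "v = (ad e ^^ (p - 1)) w"
      using free_if_inner_on[OF st inner_on_all[OF P central_step_adjoin(1)[OF st]]] v centralizer_A by blast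
    then have "v = bracket e w" by (simp add: p2)
    then have "v = l w \<cdot> z" using ue[of w] bracket_swap[of e w] by simp
    then show ?thesis by blast
  qed
  \<comment> \<open>Choose \<open>r\<close> so that \<open>y - r e\<close> commutes with \<open>x\<close>; then it commutes with \<open>A\<close> and so lies in \<open>A\<close>.\<close>
  have dec: "\<exists>r s t. y = r \<cdot> e + s \<cdot> x + t \<cdot> z" for y
  proof -
    obtain r where r: "bracket y x = r \<cdot> z" using AI[OF lie_idealD(2)[OF A_ideal x(1)] lbr] by blast
    have x0: "bracket x (y - r \<cdot> e) = 0"
      using r bracket_swap[of x y] by (simp add: bracket_diff_right bracket_scale_right ex)
    have "y - r \<cdot> e \<in> A"
    proof (rule A_centralizing)
      fix a assume a: "a \<in> A"
      have "a - l a \<cdot> x \<in> A" using a x(1) subspace_A by (simp add: subspace_diff subspace_scale)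
      then obtain s where "a - l a \<cdot> x = s \<cdot> z" using AI lx by blast
      then have "a = l a \<cdot> x + s \<cdot> z" by (simp add: algebra_simps)
      then have "bracket a v = l a \<cdot> bracket x v + s \<cdot> bracket z v" for v
        by (metis bracket_add_left bracket_scale_left)
      then show "bracket a (y - r \<cdot> e) = 0" using x0 centerD(2)[OF zc(1)] by simp
    qed
    moreover from this have "(y - r \<cdot> e) - l (y - r \<cdot> e) \<cdot> x \<in> A"
      using x(1) subspace_A by (simp add: subspace_diff subspace_scale)
    ultimately obtain t where "(y - r \<cdot> e) - l (y - r \<cdot> e) \<cdot> x = t \<cdot> z" using AI lx by blast
    then have "y = r \<cdot> e + l (y - r \<cdot> e) \<cdot> x + t \<cdot> z" by (simp add: algebra_simps)
    then show ?thesis by blast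
  qed
  show ?thesis using that[OF p2 zc(1) e(2)[symmetric] z(2) dec] .
qed

end

lemma (in lie_algebra) lie_isomorphic_heisenberg:
  assumes z: "z \<in> center" "z \<noteq> 0" and e: "bracket e x = z"
    and dec: "\<And>y. \<exists>r s t. y = r \<cdot> e + s \<cdot> x + t \<cdot> z"
  shows "lie_isomorphic scale bracket (*s) (heisenberg_bracket :: 'f ^ 3 \<Rightarrow> 'f ^ 3 \<Rightarrow> 'f ^ 3)"
proof -
  define g where "g v = (v $ 1) \<cdot> e + (v $ 2) \<cdot> x + (v $ 3) \<cdot> z" for v :: "'f ^ 3"
  have z0: "bracket u z = 0" "bracket z u = 0" for u using centerD[OF z(1)] by auto
  have xe: "bracket x e = - z" using e bracket_swap[of x e] by simp
  have gadd: "g (u + v) = g u + g v" for u v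
    by (simp add: g_def scale_left_distrib algebra_simps)
  have gscale: "g (c *s v) = c \<cdot> g v" for c v
    by (simp add: g_def scale_right_distrib)
  have gbr: "g (heisenberg_bracket u v) = bracket (g u) (g v)" for u v
    by (simp add: g_def heisenberg_bracket_def axis_def bracket_add_left bracket_add_right
        bracket_scale_left bracket_scale_right bracket_self e xe z0 scale_left_diff_distrib mult.commute)
  have "g v = 0 \<Longrightarrow> v = 0" for v
  proof -
    assume g: "g v = 0"
    have "bracket (g v) x = (v $ 1) \<cdot> z" "bracket (g v) e = - ((v $ 2) \<cdot> z)"
      by (simp_all add: g_def bracket_add_left bracket_scale_left bracket_self e xe z0)
    then have "v $ 1 = 0" "v $ 2 = 0" using g z(2) by auto
    moreover from this have "v $ 3 = 0" using g z(2) by (simp add: g_def)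
    ultimately show "v = 0" by (simp add: vec_eq_iff forall_3)
  qed
  moreover have "g (u - v) = g u - g v" for u v
    by (simp add: g_def scale_left_diff_distrib)
  ultimately have "inj g" by (intro injI) (metis right_minus_eq)
  moreover have "surj g"
  proof (rule surjI)
    fix y
    show "g (SOME v. g v = y) = y"
    proof (rule someI_ex)
      obtain r s t where "y = r \<cdot> e + s \<cdot> x + t \<cdot> z" using dec by blast
      then have "g (vector [r, s, t]) = y" by (simp add: g_def)
      then show "\<exists>v. g v = y" by blast
    qed
  qed
  ultimately have b: "bij g" by (simp add: bij_def)
  define f where "f = inv g"
  have fg: "f (g v) = v" and gf: "g (f y) = y" for v y
    using b by (simp_all add: f_def bij_is_inj surj_f_inv_f bij_is_surj)
  have "f (u + v) = f u + f v" for u v using gadd[of "f u" "f v"] fg gf by metis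
  moreover have "f (c \<cdot> u) = c *s f u" for c u using gscale[of c "f u"] fg gf by metis
  ultimately have "Vector_Spaces.linear scale (*s) f"
    unfolding Vector_Spaces.linear_iff using vector_space_axioms vec.vector_space_axioms by blast
  moreover have "f (bracket u v) = heisenberg_bracket (f u) (f v)" for u v
    using gbr[of "f u" "f v"] fg gf by metis
  ultimately show ?thesis
    unfolding lie_isomorphic_def using bij_imp_bij_inv[OF b] by (auto simp: f_def)
qed

theorem theorem1:
  fixes scale :: "'f::field \<Rightarrow> 'v::ab_group_add \<Rightarrow> 'v"
    and bracket :: "'v \<Rightarrow> 'v \<Rightarrow> 'v"
    and p :: nat
    and pmap :: "'v \<Rightarrow> 'v"
    and Basis :: "'v set"
  assumes "restricted_lie_algebra scale bracket p pmap"
    and "finite_dimensional_vector_space scale Basis"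
    and "vector_space.dim scale (UNIV :: 'v set) > 1"
    and "lie_algebra.nilpotent scale bracket"
    and "\<not> restricted_lie_algebra.torus scale bracket pmap"
    and "\<not> (p = 2 \<and>
           lie_isomorphic scale bracket (*s) (heisenberg_bracket :: 'f ^ 3 \<Rightarrow> 'f ^ 3 \<Rightarrow> 'f ^ 3))"
  shows "\<exists>D. restricted_lie_algebra.outer_restricted_derivation scale bracket p pmap D \<and>
             D \<circ> D = (\<lambda>x. 0)"
proof (rule ccontr)
  assume none: "\<not> ?thesis"
  interpret L: nilpotent_restricted_lie_algebra scale bracket p pmap Basis
    using assms(1,2,4)
    by (simp add: nilpotent_restricted_lie_algebra_def nilpotent_restricted_lie_algebra_axioms_def)
  have nonab: "\<not> L.abelian" using L.abelian_case assms(3,5) none by blast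
  obtain A where "L.lie_ideal A" "L.centralizer A = A" using L.exists_self_centralizing_ideal by blast
  then interpret S: self_centralizing_ideal scale bracket p pmap Basis A by unfold_locales
  have "L.inner_derivation D" if "L.restricted_derivation D" "D \<circ> D = (\<lambda>x. 0)" for D
    using none that L.outer_restricted_derivation_def by blast
  then show False
    using S.heisenberg_basis_exists[OF _ nonab] L.lie_isomorphic_heisenberg assms(6) by metis
qed

end
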